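(* Let $\mathfrak Z$ be a locally Gorenstein zero-dimensional subscheme of $\mathbb P^n$ over an algebraically closed field $k$, with $\operatorname{char} k=0$ or $\operatorname{char} k>j$, and let $L_{\mathfrak Z}=(I_{\mathfrak Z})^{-1}$. Then: (i) If $j\ge \beta(\mathfrak Z)$, and $F$ is a general enough element of $(L_{\mathfrak Z})_j$, then $H(R/\operatorname{Ann}(F))=\operatorname{Sym}(H_{\mathfrak Z},j)$. (ii) If $j\ge \beta(\mathfrak Z)$, and $F$ is a general enough element of $(L_{\mathfrak Z})_j$, then for $i$ satisfying $\tau(\mathfrak Z)\le i\le j-\alpha(\mathfrak Z)$ we have $\operatorname{Ann}(F)_i=(I_{\mathfrak Z})_i$. Equivalently, we have $R_{j-i}\circ F=(L_{\mathfrak Z})_i$. (iii) If $j\ge\max\{\beta(\mathfrak Z),2\tau(\mathfrak Z)+1\}$, and $F\in (L_{\mathfrak Z})_j$ is general enough, then $\operatorname{Ann}(F)$ determines $\mathfrak Z$ uniquely. If $I_{\mathfrak Z}$ is generated in degree $\tau(\mathfrak Z)$, then $j\ge \max\{\beta(\mathfrak Z),2\tau(\mathfrak Z)\}$ suffices.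
   Context: $R=k[x_1,\dots,x_{n+1}]$ is the graded coordinate ring of $\mathbb P^n$, and $\Gamma=k_{DP}[X_1,\dots,X_{n+1}]$ is the divided power ring, with $k$-basis the monomials $X^{[U]}$, $U\in\mathbb N^{n+1}$, and product $X^{[U]}X^{[V]}=\binom{U+V}{U}X^{[U+V]}$. $R$ acts on $\Gamma$ by contraction: $x^K\circ X^{[U]}=X^{[U-K]}$, which is $0$ if some component of $U-K$ is negative. For a graded ideal $I\subset R$ its inverse system is $I^{-1}=\bigoplus_j\{F\in\Gamma_j: h\circ F=0\ \forall h\in I_j\}$. For $F\in\Gamma_j$, $\operatorname{Ann}(F)=\{h\in R: h\circ F=0\}$, a graded ideal, and $H(R/\operatorname{Ann}(F))$ is the Hilbert function of the quotient. For a zero-dimensional subscheme $\mathfrak Z\subset\mathbb P^n$ of degree $s$, $I_{\mathfrak Z}\subset R$ is its saturated defining ideal, and $H_{\mathfrak Z}$ is the Hilbert function $(H_{\mathfrak Z})_i=\dim_k(R/I_{\mathfrak Z})_i$; $\tau(\mathfrak Z)=\min\{i: (H_{\mathfrak Z})_i=s\}$. $\alpha(\mathfrak Z)$ is the maximum, over the points $p$ of the support, of the socle degree of the Artinian local ring $\mathcal O_{\mathfrak Z,p}$, i.e. of the largest $i$ with $\mathfrak m_p^i\mathcal O_{\mathfrak Z,p}\ne0$. Set $\beta(\mathfrak Z)=\tau(\mathfrak Z)+\max\{\tau(\mathfrak Z),\alpha(\mathfrak Z)\}$. $\mathfrak Z$ is locally Gorenstein if every $\mathcal O_{\mathfrak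 Z,p}$ is Gorenstein. For a positive integer $j$, $\operatorname{Sym}(H_{\mathfrak Z},j)$ is the sequence with $\operatorname{Sym}(H_{\mathfrak Z},j)_i=(H_{\mathfrak Z})_i$ if $i\le j/2$ and $\operatorname{Sym}(H_{\mathfrak Z},j)_i=(H_{\mathfrak Z})_{j-i}$ if $i\ge j/2$ (so it is $0$ for $i>j$). "General enough element of $(L_{\mathfrak Z})_j$" means an element of some nonempty Zariski-open subset of the vector space $(L_{\mathfrak Z})_j$.
   Formalization: In (ii) the range is τ ≤ i ≤ j − max{τ, α} instead of τ ≤ i ≤ j − α: for j − τ < i ≤ j − α the printed equalities fail for every F (e.g. two reduced points of P^1, j = i = 2). *)

theory Defs
  imports
    "HOL-Library.Poly_Mapping"
    "HOL-Computational_Algebra.Computational_Algebra"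
    "HOL-Algebra.Ideal_Product"
begin

subsection \<open>The coordinate ring of projective space\<close>

text \<open>For a finite type \<open>'v\<close> with \<open>n + 1\<close> elements, \<open>('v, 'k) mpoly\<close> is the polynomial ring
  \<open>R = k[x\<^sub>1, \<dots>, x\<^sub>n\<^sub>+\<^sub>1]\<close>: a finitely supported coefficient function on exponent vectors.\<close>

type_synonym ('v, 'k) mpoly = "('v \<Rightarrow>\<^sub>0 nat) \<Rightarrow>\<^sub>0 'k"

definition mdeg :: "('v::finite \<Rightarrow>\<^sub>0 nat) \<Rightarrow> nat" where
  "mdeg m = (\<Sum>v\<in>UNIV. Poly_Mapping.lookup m v)"

definition homog :: "nat \<Rightarrow> ('v::finite, 'k::field) mpoly set" where
  "homog i = {f. \<forall>m\<in>Poly_Mapping.keys f. mdeg m = i}"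

text \<open>Evaluation also makes sense for polynomials in infinitely many variables, which is used
  below for polynomial functions of the coefficients of a form.\<close>

definition eval_mpoly :: "('x, 'k::field) mpoly \<Rightarrow> ('x \<Rightarrow> 'k) \<Rightarrow> 'k" where
  "eval_mpoly f a = (\<Sum>m\<in>Poly_Mapping.keys f. Poly_Mapping.lookup f m * (\<Prod>x\<in>Poly_Mapping.keys m. a x ^ Poly_Mapping.lookup m x))"

definition scale_mpoly :: "'k::field \<Rightarrow> ('v, 'k) mpoly \<Rightarrow> ('v, 'k) mpoly" where
  "scale_mpoly c f = Poly_Mapping.single 0 c * f"

definition dim_mpoly :: "('v, 'k::field) mpoly set \<Rightarrow> nat" where
  "dim_mpoly = vector_space.dim scale_mpoly"

definition is_ideal :: "('v, 'k::field) mpoly set \<Rightarrow> bool" where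
  "is_ideal I \<longleftrightarrow> module.subspace (*) I"

definition ideal_gen :: "('v, 'k::field) mpoly set \<Rightarrow> ('v, 'k) mpoly set" where
  "ideal_gen S = module.span (*) S"

definition hom_component :: "nat \<Rightarrow> ('v::finite, 'k::field) mpoly \<Rightarrow> ('v, 'k) mpoly" where
  "hom_component i f =
     (\<Sum>m\<in>{m\<in>Poly_Mapping.keys f. mdeg m = i}. Poly_Mapping.single m (Poly_Mapping.lookup f m))"

definition homogeneous_ideal :: "('v::finite, 'k::field) mpoly set \<Rightarrow> bool" where
  "homogeneous_ideal I \<longleftrightarrow> is_ideal I \<and> (\<forall>f\<in>I. \<forall>i. hom_component i f \<in> I)"

definition saturated :: "('v::finite, 'k::field) mpoly set \<Rightarrow> bool" where
  "saturated I \<longleftrightarrow> (\<forall>f. (\<exists>N. \<forall>g\<in>homog N. g * f \<in> I) \<longrightarrow> f \<in> I)"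

text \<open>The dimension of \<open>(R/I)\<^sub>i = R\<^sub>i/I\<^sub>i\<close> over \<open>k\<close>.\<close>

definition hilbert_fun :: "('v::finite, 'k::field) mpoly set \<Rightarrow> nat \<Rightarrow> nat" where
  "hilbert_fun I i = dim_mpoly (homog i :: ('v, 'k) mpoly set) - dim_mpoly (I \<inter> homog i)"

subsection \<open>Zero-dimensional subschemes\<close>

text \<open>A closed subscheme of projective space is given by its saturated homogeneous ideal. The
  closed points of its support are orbits, under nonzero scalars, of nonzero vectors.\<close>

definition zeros :: "('v, 'k::field) mpoly set \<Rightarrow> ('v \<Rightarrow> 'k) set" where
  "zeros I = {a. a \<noteq> (\<lambda>_. 0) \<and> (\<forall>f\<in>I. eval_mpoly f a = 0)}"

definition proj_point :: "('v \<Rightarrow> 'k::field) \<Rightarrow> ('v \<Rightarrow> 'k) set" where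
  "proj_point a = {b. \<exists>c. c \<noteq> 0 \<and> b = (\<lambda>v. c * a v)}"

definition support :: "('v, 'k::field) mpoly set \<Rightarrow> ('v \<Rightarrow> 'k) set set" where
  "support I = proj_point ` zeros I"

text \<open>The degree \<open>s\<close> is the constant value of the Hilbert polynomial.\<close>

definition zero_dim_subscheme :: "('v::finite, 'k::field) mpoly set \<Rightarrow> nat \<Rightarrow> bool" where
  "zero_dim_subscheme I s \<longleftrightarrow>
     homogeneous_ideal I \<and> saturated I \<and>
     finite (support I) \<and> support I \<noteq> {} \<and>
     (\<forall>\<^sub>F i in sequentially. hilbert_fun I i = s)"

definition tau :: "('v::finite, 'k::field) mpoly set \<Rightarrow> nat \<Rightarrow> nat" where
  "tau I s = (LEAST i. hilbert_fun I i = s)"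

subsection \<open>Local rings\<close>

text \<open>The local ring at the point represented by \<open>a\<close> is the degree-zero part of the localization
  of \<open>R/I\<close> at the homogeneous prime ideal of that point: fractions \<open>f/g\<close> of forms of equal
  degree with \<open>g(a) \<noteq> 0\<close>. It depends only on the point, not on the representative.\<close>

definition fractions :: "('v::finite \<Rightarrow> 'k::field) \<Rightarrow> (('v, 'k) mpoly \<times> ('v, 'k) mpoly) set" where
  "fractions a = {(f, g). \<exists>d. f \<in> homog d \<and> g \<in> homog d \<and> eval_mpoly g a \<noteq> 0}"

definition frac_rel :: "('v::finite, 'k::field) mpoly set \<Rightarrow> ('v \<Rightarrow> 'k)
    \<Rightarrow> ((('v, 'k) mpoly \<times> ('v, 'k) mpoly) \<times> (('v, 'k) mpoly \<times> ('v, 'k) mpoly)) set" where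
  "frac_rel I a = {((f, g), (f', g')). (f, g) \<in> fractions a \<and> (f', g') \<in> fractions a \<and>
     (\<exists>d. \<exists>u\<in>homog d. eval_mpoly u a \<noteq> 0 \<and> u * (f * g' - f' * g) \<in> I)}"

definition local_ring :: "('v::finite, 'k::field) mpoly set \<Rightarrow> ('v \<Rightarrow> 'k)
    \<Rightarrow> (('v, 'k) mpoly \<times> ('v, 'k) mpoly) set ring" where
  "local_ring I a =
     \<lparr>carrier = fractions a // frac_rel I a,
      mult = (\<lambda>X Y. \<Union>(f, g)\<in>X. \<Union>(f', g')\<in>Y. frac_rel I a `` {(f * f', g * g')}),
      one = frac_rel I a `` {(1, 1)},
      zero = frac_rel I a `` {(0, 1)},
      add = (\<lambda>X Y. \<Union>(f, g)\<in>X. \<Union>(f', g')\<in>Y. frac_rel I a `` {(f * g' + f' * g, g * g')})\<rparr>"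

definition max_ideal :: "('a, 'b) ring_scheme \<Rightarrow> 'a set" where
  "max_ideal A = (THE M. maximalideal M A)"

fun ideal_power :: "('a, 'b) ring_scheme \<Rightarrow> 'a set \<Rightarrow> nat \<Rightarrow> 'a set" where
  "ideal_power A M 0 = carrier A"
| "ideal_power A M (Suc i) = ideal_prod A M (ideal_power A M i)"

definition socle_degree :: "('a, 'b) ring_scheme \<Rightarrow> nat" where
  "socle_degree A = (GREATEST i. ideal_power A (max_ideal A) i \<noteq> {\<zero>\<^bsub>A\<^esub>})"

definition socle :: "('a, 'b) ring_scheme \<Rightarrow> 'a set" where
  "socle A = {x \<in> carrier A. \<forall>y\<in>max_ideal A. y \<otimes>\<^bsub>A\<^esub> x = \<zero>\<^bsub>A\<^esub>}"

text \<open>For an Artinian local ring: the socle is one-dimensional over the residue field. Since the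
  maximal ideal kills the socle, the residue field multiples of \<open>x\<close> are the elements of the
  principal ideal of \<open>x\<close>.\<close>

definition gorenstein_artinian :: "('a, 'b) ring_scheme \<Rightarrow> bool" where
  "gorenstein_artinian A \<longleftrightarrow> (\<exists>x\<in>socle A. x \<noteq> \<zero>\<^bsub>A\<^esub> \<and> socle A = PIdl\<^bsub>A\<^esub> x)"

definition locally_gorenstein :: "('v::finite, 'k::field) mpoly set \<Rightarrow> bool" where
  "locally_gorenstein I \<longleftrightarrow> (\<forall>a\<in>zeros I. gorenstein_artinian (local_ring I a))"

definition alpha :: "('v::finite, 'k::field) mpoly set \<Rightarrow> nat" where
  "alpha I = Max ((\<lambda>a. socle_degree (local_ring I a)) ` zeros I)"

definition beta :: "('v::finite, 'k::field) mpoly set \<Rightarrow> nat \<Rightarrow> nat" where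
  "beta I s = tau I s + max (tau I s) (alpha I)"

text \<open>By the symmetry of \<open>H(R/Ann F)\<close>, the equality of \<open>Ann F\<close> and \<open>I\<close> in a degree \<open>i\<close> with
  \<open>\<tau> \<le> i\<close> can hold for general \<open>F\<close> only if \<open>i \<le> j - \<tau>\<close>, a bound that \<open>i \<le> j - \<alpha>\<close> implies
  only when \<open>\<tau> \<le> \<alpha>\<close>. Two reduced points (\<open>\<alpha> = 0\<close>) and \<open>i = j\<close> show that it cannot be omitted: the
  form \<open>F\<close> spans a line, but the inverse system has dimension two in degree \<open>j\<close>.\<close>

subsection \<open>Inverse systems\<close>

text \<open>The divided power ring has the basis \<open>X\<^sup>[\<^sup>U\<^sup>]\<close> indexed by exponent vectors, so its elements
  are again finitely supported coefficient functions; only its graded vector space structure and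
  the contraction action are needed, and the multiplication of \<open>mpoly\<close> plays no role for it.\<close>

type_synonym ('v, 'k) dpoly = "('v \<Rightarrow>\<^sub>0 nat) \<Rightarrow>\<^sub>0 'k"

definition contract :: "('v, 'k::field) mpoly \<Rightarrow> ('v, 'k) dpoly \<Rightarrow> ('v, 'k) dpoly" where
  "contract h F = (\<Sum>K\<in>Poly_Mapping.keys h. \<Sum>U\<in>Poly_Mapping.keys F.
     if \<forall>v. Poly_Mapping.lookup K v \<le> Poly_Mapping.lookup U v
     then Poly_Mapping.single (U - K) (Poly_Mapping.lookup h K * Poly_Mapping.lookup F U) else 0)"

definition inverse_system :: "('v::finite, 'k::field) mpoly set \<Rightarrow> nat \<Rightarrow> ('v, 'k) dpoly set" where
  "inverse_system I j = {F \<in> homog j. \<forall>h\<in>I \<inter> homog j. contract h F = 0}"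

definition Ann :: "('v, 'k::field) dpoly \<Rightarrow> ('v, 'k) mpoly set" where
  "Ann F = {h. contract h F = 0}"

definition Sym :: "(nat \<Rightarrow> nat) \<Rightarrow> nat \<Rightarrow> nat \<Rightarrow> nat" where
  "Sym H j i = (if 2 * i \<le> j then H i else if i \<le> j then H (j - i) else 0)"

subsection \<open>General elements\<close>

text \<open>The closed sets of the Zariski topology on a space \<open>W\<close> of forms are the zero sets in \<open>W\<close> of
  sets of polynomials in the coefficients.\<close>

definition zariski_open_in :: "('v, 'k::field) dpoly set \<Rightarrow> ('v, 'k) dpoly set \<Rightarrow> bool" where
  "zariski_open_in W U \<longleftrightarrow>
     (\<exists>S :: ('v \<Rightarrow>\<^sub>0 nat, 'k) mpoly set. U = {F \<in> W. \<exists>P\<in>S. eval_mpoly P (Poly_Mapping.lookup F) \<noteq> 0})"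

definition holds_generally :: "('v, 'k::field) dpoly set \<Rightarrow> (('v, 'k) dpoly \<Rightarrow> bool) \<Rightarrow> bool" where
  "holds_generally W Q \<longleftrightarrow> (\<exists>U. zariski_open_in W U \<and> U \<noteq> {} \<and> (\<forall>F\<in>U. Q F))"

end

theory Submission
  imports Defs "Jordan_Normal_Form.Char_Poly"
begin

text \<open>Let \<open>A = R/I\<close> be the coordinate ring of the scheme. A linear form \<open>l\<close> that vanishes at no point
  of the support is a nonzerodivisor on \<open>A\<close>, and division by \<open>l\<^sup>i\<close> embeds \<open>A\<^sub>i\<close> in the algebra \<open>O\<close> of
  functions on the scheme, which has dimension \<open>s\<close>. The images increase with \<open>i\<close> and equal \<open>O\<close> from
  \<open>i = \<tau>\<close> on. An element \<open>F\<close> of the inverse system in degree \<open>j\<close> is a linear functional on \<open>A\<^sub>j\<close>, and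
  contraction is adjoint to multiplication (\<open>ip_contract\<close>): a form \<open>h\<close> annihilates \<open>F\<close> if and only if
  \<open>F\<close> vanishes on all multiples of \<open>h\<close> in degree \<open>j\<close>. So \<open>Ann F\<close> is governed by the bilinear forms
  \<open>(g, h) \<mapsto> F(g h)\<close> on \<open>A\<^sub>j\<^sub>-\<^sub>i \<times> A\<^sub>i\<close>, and the point is that for general \<open>F\<close> the form on
  \<open>A\<^sub>\<tau> \<times> A\<^sub>j\<^sub>-\<^sub>\<tau>\<close> is nondegenerate. Here \<open>j \<ge> \<beta> \<ge> 2\<tau>\<close>, so both factors are copies of \<open>O\<close>.

  A nondegenerate \<open>F\<close> exists (\<open>nondegenerate_exists\<close>) because the radical of the form is an ideal of
  \<open>O\<close>. If that ideal is nonzero, it contains a common eigenvector of the variables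
  (\<open>common_eigenvector_mod_ideal_exists\<close>); the eigenvalues are the coordinates of a point of the
  scheme, and the eigenvector lies in the socle of the local ring there. The local rings are
  Gorenstein, so these eigenvectors form one line for each point
  (\<open>gorenstein_eigenvector_unique\<close>), and a functional that is nonzero on finitely many lines excludes
  all of them. Nondegeneracy is the nonvanishing of a determinant whose entries are linear in the
  coefficients of \<open>F\<close>, hence an open condition (\<open>nondegenerate_generally\<close>).

  If \<open>F\<close> is nondegenerate, then saturation gives \<open>Ann(F)\<^sub>i = I\<^sub>i\<close> for all \<open>i \<le> j - \<tau>\<close>
  (\<open>Ann_eq_ideal\<close>). This is the lower half of the Hilbert function; the upper half follows since the
  form on \<open>R\<^sub>j\<^sub>-\<^sub>i \<times> R\<^sub>i\<close> has the same rank from both sides, and double orthogonality gives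
  \<open>R\<^sub>j\<^sub>-\<^sub>i \<circ> F = L\<^sub>i\<close>. Finally \<open>I\<close> is generated in degrees up to \<open>\<tau> + 1\<close>
  (\<open>ideal_generated_above_tau\<close>), so it is the saturation of the ideal generated by
  \<open>I\<^sub>d = Ann(F)\<^sub>d\<close> for \<open>d = \<lceil>j/2\<rceil>\<close>, which lies between \<open>\<tau> + 1\<close> (or \<open>\<tau>\<close>, if \<open>I\<close> is generated there)
  and \<open>j - \<tau>\<close>.

  The existence of \<open>l\<close> (\<open>regular_if_nonzero_on_zeros\<close>) takes the place of the Nullstellensatz and of
  primary decomposition: if \<open>l\<close> were a zero divisor, a common eigenvector in the \<open>l\<close>-torsion of a
  localization of \<open>A\<close> would produce a point of the support at which \<open>l\<close> vanishes.\<close>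

section \<open>Polynomials as finitely supported functions\<close>

abbreviation coef :: "('a \<Rightarrow>\<^sub>0 'b::zero) \<Rightarrow> 'a \<Rightarrow> 'b" where
  "coef \<equiv> Poly_Mapping.lookup"

abbreviation Var :: "'v \<Rightarrow> ('v, 'k::field) mpoly" where
  "Var v \<equiv> Poly_Mapping.single (Poly_Mapping.single v (Suc 0)) 1"

lemma coef_scale [simp]: "coef (scale_mpoly c f) m = c * coef f m"
  unfolding scale_mpoly_def mult_map_scale_conv_mult[symmetric]
  by (simp add: Poly_Mapping.map.rep_eq when_def)

interpretation mp: vector_space "scale_mpoly :: 'k::field \<Rightarrow> ('v, 'k) mpoly \<Rightarrow> ('v, 'k) mpoly"
  by unfold_locales (auto intro!: poly_mapping_eqI simp: lookup_add algebra_simps)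

lemma scale_mult_left: "scale_mpoly c f * g = scale_mpoly c (f * g)"
  by (simp add: scale_mpoly_def mult.assoc)

lemma scale_mult_right: "f * scale_mpoly c g = scale_mpoly c (f * g)"
  by (simp add: scale_mpoly_def mult.left_commute)

lemma sum_single_keys:
  assumes "finite A" "Poly_Mapping.keys f \<subseteq> A"
  shows "(\<Sum>m\<in>A. Poly_Mapping.single m (coef f m)) = f"
proof (rule poly_mapping_eqI)
  fix k
  have "(\<Sum>m\<in>A. coef (Poly_Mapping.single m (coef f m)) k) = (\<Sum>m\<in>A. if m = k then coef f k else 0)"
    by (intro sum.cong) (auto simp: lookup_single when_def)
  also have "\<dots> = coef f k"
    using assms by (auto simp: in_keys_iff)
  finally show "coef (\<Sum>m\<in>A. Poly_Mapping.single m (coef f m)) k = coef f k"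
    by (simp add: lookup_sum)
qed

lemma mpoly_expand: "f = (\<Sum>m\<in>Poly_Mapping.keys f. scale_mpoly (coef f m) (Poly_Mapping.single m 1))"
proof -
  have "scale_mpoly (coef f m) (Poly_Mapping.single m 1) = Poly_Mapping.single m (coef f m)" for m
    by (simp add: scale_mpoly_def mult_single)
  then show ?thesis using sum_single_keys[of "Poly_Mapping.keys f" f] by simp
qed

lemma homogD: "f \<in> homog i \<Longrightarrow> coef f m \<noteq> 0 \<Longrightarrow> mdeg m = i"
  by (auto simp: homog_def in_keys_iff)

lemma homogI: "(\<And>m. coef f m \<noteq> 0 \<Longrightarrow> mdeg m = i) \<Longrightarrow> f \<in> homog i"
  by (auto simp: homog_def in_keys_iff)

lemma homog_subspace: "mp.subspace (homog i)"
  by (rule mp.subspaceI) (auto simp: homog_def in_keys_iff lookup_add)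

lemmas homog_0 [simp] = mp.subspace_0[OF homog_subspace]
  and homog_add = mp.subspace_add[OF homog_subspace]
  and homog_diff = mp.subspace_diff[OF homog_subspace]
  and homog_scale = mp.subspace_scale[OF homog_subspace]
  and homog_sum = mp.subspace_sum[OF homog_subspace]

lemma mdeg_add: "mdeg (m + n) = mdeg m + mdeg n"
  by (simp add: mdeg_def lookup_add sum.distrib)

lemma mdeg_0 [simp]: "mdeg 0 = 0"
  by (simp add: mdeg_def)

lemma mdeg_single [simp]: "mdeg (Poly_Mapping.single v n) = n"
  by (simp add: mdeg_def lookup_single when_def)

lemma mdeg_eq_0_iff: "mdeg m = 0 \<longleftrightarrow> m = 0"
  by (auto simp: mdeg_def intro: poly_mapping_eqI)

lemma homog_mult: "f \<in> homog i \<Longrightarrow> g \<in> homog j \<Longrightarrow> f * g \<in> homog (i + j)"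
  using keys_mult[of f g] by (fastforce simp: homog_def mdeg_add)

lemma homog_1 [simp]: "1 \<in> homog 0"
  by (simp add: homog_def)

lemma homog_monom: "mdeg m = i \<Longrightarrow> Poly_Mapping.single m c \<in> homog i"
  by (auto simp: homog_def)

lemma homog_Var [simp]: "Var v \<in> homog 1" "Var v \<in> homog (Suc 0)"
  by (auto simp: homog_def)

lemma homog_power: "f \<in> homog i \<Longrightarrow> f ^ n \<in> homog (i * n)"
  by (induct n) (auto intro: homog_mult)

lemma homog_power_1: "f \<in> homog 1 \<Longrightarrow> f ^ n \<in> homog n"
  using homog_power[of f 1 n] by simp

lemma homog_hom_component: "hom_component i f \<in> homog i"
  unfolding hom_component_def by (intro homog_sum homog_monom) auto

lemma coef_hom_component: "coef (hom_component i f) m = (if mdeg m = i then coef f m else 0)"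
proof -
  have "(\<Sum>n\<in>{m \<in> Poly_Mapping.keys f. mdeg m = i}. coef (Poly_Mapping.single n (coef f n)) m)
      = (\<Sum>n\<in>{m \<in> Poly_Mapping.keys f. mdeg m = i}. if n = m then coef f m else 0)"
    by (intro sum.cong) (auto simp: lookup_single when_def)
  then show ?thesis
    by (auto simp: hom_component_def lookup_sum in_keys_iff)
qed

lemma hom_component_homog: "f \<in> homog i \<Longrightarrow> hom_component k f = (if k = i then f else 0)"
  by (auto intro!: poly_mapping_eqI simp: coef_hom_component dest: homogD)

lemma sum_hom_components: "\<exists>B. f = (\<Sum>i<B. hom_component i f)"
proof -
  define B where "B = Suc (Max (insert 0 (mdeg ` Poly_Mapping.keys f)))"
  have "mdeg m < B" if "coef f m \<noteq> 0" for m
    using that unfolding B_def by (auto simp: less_Suc_eq_le in_keys_iff intro!: Max_ge)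
  then have "f = (\<Sum>i<B. hom_component i f)"
    by (intro poly_mapping_eqI) (auto simp: lookup_sum coef_hom_component)
  then show ?thesis ..
qed

lemma finite_mdeg: "finite {m :: 'v::finite \<Rightarrow>\<^sub>0 nat. mdeg m = i}"
proof -
  have "coef ` {m :: 'v \<Rightarrow>\<^sub>0 nat. mdeg m = i} \<subseteq> Pi\<^sub>E UNIV (\<lambda>_. {..i})"
    by (auto simp: mdeg_def intro: member_le_sum)
  moreover have "finite (Pi\<^sub>E (UNIV :: 'v set) (\<lambda>_. {..i}))"
    by (intro finite_PiE) auto
  ultimately have "finite (coef ` {m :: 'v \<Rightarrow>\<^sub>0 nat. mdeg m = i})"
    using finite_subset by blast
  then show ?thesis
    by (rule finite_imageD) (auto simp: inj_on_def)
qed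

lemma homog_finite_span:
  "\<exists>T. finite T \<and> (homog i :: ('v::finite, 'k::field) mpoly set) \<subseteq> mp.span T"
proof (intro exI conjI subsetI)
  show "finite ((\<lambda>m. Poly_Mapping.single m 1) ` {m :: 'v \<Rightarrow>\<^sub>0 nat. mdeg m = i})"
    by (simp add: finite_mdeg)
  fix f :: "('v, 'k) mpoly" assume f: "f \<in> homog i"
  have "(\<Sum>m\<in>Poly_Mapping.keys f. scale_mpoly (coef f m) (Poly_Mapping.single m 1))
      \<in> mp.span ((\<lambda>m. Poly_Mapping.single m 1) ` {m :: 'v \<Rightarrow>\<^sub>0 nat. mdeg m = i})"
    using f by (intro mp.span_sum mp.span_scale mp.span_base) (auto simp: homog_def)
  then show "f \<in> mp.span ((\<lambda>m. Poly_Mapping.single m 1) ` {m :: 'v \<Rightarrow>\<^sub>0 nat. mdeg m = i})"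
    by (simp only: mpoly_expand[symmetric])
qed

lemma mdeg_Suc_decomp:
  assumes "mdeg (m :: 'v::finite \<Rightarrow>\<^sub>0 nat) = Suc d"
  obtains v m' where "m = Poly_Mapping.single v (Suc 0) + m'" "mdeg m' = d"
proof -
  from assms have "m \<noteq> 0" by auto
  then obtain v where v: "coef m v \<noteq> 0"
    by (metis lookup_zero poly_mapping_eqI)
  define m' where "m' = m - Poly_Mapping.single v (Suc 0)"
  have eq: "m = Poly_Mapping.single v (Suc 0) + m'"
    by (rule poly_mapping_eqI) (use v in \<open>auto simp: m'_def lookup_add lookup_minus lookup_single when_def\<close>)
  moreover have "mdeg m' = d"
    using assms by (subst (asm) eq) (simp add: mdeg_add)
  ultimately show ?thesis using that by blast
qed

text \<open>Statements that are stable under linear combinations need only be checked on products of a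
  variable with a form of lower degree.\<close>

lemma homog_Suc_induct:
  assumes "f \<in> homog (Suc d)" and S: "mp.subspace S"
    and "\<And>v g. g \<in> homog d \<Longrightarrow> Var v * g \<in> S"
  shows "f \<in> S"
proof (subst mpoly_expand[of f], rule mp.subspace_sum[OF S])
  fix m assume "m \<in> Poly_Mapping.keys f"
  then have "mdeg m = Suc d" using assms(1) by (auto simp: homog_def)
  then obtain v m' where m: "m = Poly_Mapping.single v (Suc 0) + m'" "mdeg m' = d"
    by (rule mdeg_Suc_decomp)
  have "Var v * Poly_Mapping.single m' 1 \<in> S"
    using m by (intro assms homog_monom)
  then show "scale_mpoly (coef f m) (Poly_Mapping.single m 1) \<in> S"
    using m by (auto simp: mult_single intro: mp.subspace_scale[OF S])
qed

lemma homog_0_iff: "f \<in> homog 0 \<longleftrightarrow> (\<exists>c. f = scale_mpoly c 1)"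
proof
  assume f: "f \<in> homog 0"
  have "f = scale_mpoly (coef f 0) 1"
    by (rule poly_mapping_eqI) (use f in \<open>auto simp: lookup_one when_def mdeg_eq_0_iff dest: homogD\<close>)
  then show "\<exists>c. f = scale_mpoly c 1" ..
qed (auto intro: homog_scale)

subsection \<open>Evaluation\<close>

definition mono_eval :: "('x \<Rightarrow>\<^sub>0 nat) \<Rightarrow> ('x \<Rightarrow> 'k::field) \<Rightarrow> 'k" where
  "mono_eval m a = (\<Prod>x\<in>Poly_Mapping.keys m. a x ^ coef m x)"

lemma mono_eval_superset:
  assumes "finite A" "Poly_Mapping.keys m \<subseteq> A"
  shows "mono_eval m a = (\<Prod>x\<in>A. a x ^ coef m x)"
  unfolding mono_eval_def by (rule prod.mono_neutral_left) (use assms in \<open>auto simp: in_keys_iff\<close>)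

lemma mono_eval_add: "mono_eval (m + n) a = mono_eval m a * mono_eval n a"
proof -
  let ?A = "Poly_Mapping.keys m \<union> Poly_Mapping.keys n"
  have "mono_eval (m + n) a = (\<Prod>x\<in>?A. a x ^ coef (m + n) x)"
    by (rule mono_eval_superset) (use Poly_Mapping.keys_add[of m n] in auto)
  also have "\<dots> = (\<Prod>x\<in>?A. a x ^ coef m x) * (\<Prod>x\<in>?A. a x ^ coef n x)"
    by (simp add: lookup_add power_add prod.distrib)
  also have "\<dots> = mono_eval m a * mono_eval n a"
    by (subst (1 2) mono_eval_superset[of ?A]) auto
  finally show ?thesis .
qed

lemma mono_eval_simps [simp]: "mono_eval 0 a = 1" "mono_eval (Poly_Mapping.single v n) a = a v ^ n"
  by (auto simp: mono_eval_def)

lemma eval_superset: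
  assumes "finite A" "Poly_Mapping.keys f \<subseteq> A"
  shows "eval_mpoly f a = (\<Sum>m\<in>A. coef f m * mono_eval m a)"
  unfolding eval_mpoly_def mono_eval_def[symmetric]
  by (rule sum.mono_neutral_left) (use assms in \<open>auto simp: in_keys_iff\<close>)

lemma eval_add: "eval_mpoly (f + g) a = eval_mpoly f a + eval_mpoly g a"
proof -
  let ?A = "Poly_Mapping.keys f \<union> Poly_Mapping.keys g"
  have "eval_mpoly (f + g) a = (\<Sum>m\<in>?A. coef (f + g) m * mono_eval m a)"
    by (rule eval_superset) (use Poly_Mapping.keys_add[of f g] in auto)
  also have "\<dots> = (\<Sum>m\<in>?A. coef f m * mono_eval m a) + (\<Sum>m\<in>?A. coef g m * mono_eval m a)"
    by (simp add: lookup_add algebra_simps sum.distrib)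
  also have "\<dots> = eval_mpoly f a + eval_mpoly g a"
    by (subst (1 2) eval_superset[of ?A]) auto
  finally show ?thesis .
qed

lemma eval_single [simp]: "eval_mpoly (Poly_Mapping.single m c) a = c * mono_eval m a"
  by (subst eval_superset[of "{m}"]) auto

lemma eval_0 [simp]: "eval_mpoly 0 a = 0"
  by (simp add: eval_mpoly_def)

lemma eval_1 [simp]: "eval_mpoly 1 a = 1"
  by (simp add: eval_mpoly_def)

lemma eval_sum: "eval_mpoly (sum f A) a = (\<Sum>x\<in>A. eval_mpoly (f x) a)"
  by (induct A rule: infinite_finite_induct) (auto simp: eval_add)

lemma eval_scale [simp]: "eval_mpoly (scale_mpoly c f) a = c * eval_mpoly f a"
  by (subst (1 2) eval_superset[of "Poly_Mapping.keys f"])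
     (auto simp: in_keys_iff sum_distrib_left mult.assoc)

lemma eval_uminus: "eval_mpoly (- f) a = - eval_mpoly f a"
  using eval_add[of f "- f" a] by (simp add: eq_neg_iff_add_eq_0 add.commute)

lemma eval_diff: "eval_mpoly (f - g) a = eval_mpoly f a - eval_mpoly g a"
  using eval_add[of f "- g" a] by (simp add: eval_uminus)

lemma eval_mult: "eval_mpoly (f * g) a = eval_mpoly f a * eval_mpoly g a"
proof -
  let ?s = "\<lambda>f m. Poly_Mapping.single m (coef f m)"
  have "eval_mpoly (f * g) a
      = eval_mpoly ((\<Sum>m\<in>Poly_Mapping.keys f. ?s f m) * (\<Sum>n\<in>Poly_Mapping.keys g. ?s g n)) a"
    by (simp add: sum_single_keys)
  also have "\<dots> = (\<Sum>m\<in>Poly_Mapping.keys f. \<Sum>n\<in>Poly_Mapping.keys g.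
      coef f m * coef g n * (mono_eval m a * mono_eval n a))"
    by (simp add: sum_product eval_sum mult_single mono_eval_add)
  also have "\<dots> = eval_mpoly f a * eval_mpoly g a"
    by (simp add: eval_superset[OF finite_keys order_refl] sum_product algebra_simps)
  finally show ?thesis .
qed

lemma eval_power: "eval_mpoly (f ^ n) a = eval_mpoly f a ^ n"
  by (induct n) (auto simp: eval_mult)

lemma eval_homog_scaled:
  assumes "f \<in> homog d"
  shows "eval_mpoly f (\<lambda>v. c * a v) = c ^ d * eval_mpoly f a"
proof -
  have "mono_eval m (\<lambda>v. c * a v) = c ^ mdeg m * mono_eval m a" for m :: "'a \<Rightarrow>\<^sub>0 nat"
    by (simp add: mono_eval_superset[of UNIV] power_mult_distrib prod.distrib mdeg_def power_sum)
  then show ?thesis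
    using assms by (auto simp: eval_superset[OF finite_keys order_refl] sum_distrib_left homog_def
      intro!: sum.cong)
qed

subsection \<open>Ideals\<close>

lemma mult_module: "Modules.module ((*) :: 'a::comm_ring_1 \<Rightarrow> 'a \<Rightarrow> 'a)"
  by unfold_locales (auto simp: algebra_simps)

lemma is_ideal_iff:
  "is_ideal I \<longleftrightarrow> 0 \<in> I \<and> (\<forall>x\<in>I. \<forall>y\<in>I. x + y \<in> I) \<and> (\<forall>g. \<forall>x\<in>I. g * x \<in> I)"
  unfolding is_ideal_def Modules.module.subspace_def[OF mult_module] by blast

lemma is_ideal_mult:
  assumes "is_ideal I" "f \<in> I"
  shows "g * f \<in> I" "f * g \<in> I"
proof -
  show "g * f \<in> I"
    using assms by (simp add: is_ideal_iff)
  then show "f * g \<in> I" by (simp only: mult.commute)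
qed

lemma is_ideal_subspace:
  assumes "is_ideal I"
  shows "mp.subspace I"
proof (rule mp.subspaceI)
  show "x + y \<in> I" if "x \<in> I" "y \<in> I" for x y
    using assms that by (simp_all add: is_ideal_iff)
  show "0 \<in> I"
    using assms by (simp add: is_ideal_iff)
  show "scale_mpoly c x \<in> I" if "x \<in> I" for c x
    unfolding scale_mpoly_def using assms that by (rule is_ideal_mult)
qed

lemmas is_ideal_0 = is_ideal_subspace[THEN mp.subspace_0]
  and is_ideal_add = is_ideal_subspace[THEN mp.subspace_add]
  and is_ideal_diff = is_ideal_subspace[THEN mp.subspace_diff]
  and is_ideal_scale = is_ideal_subspace[THEN mp.subspace_scale]
  and is_ideal_sum = is_ideal_subspace[THEN mp.subspace_sum]

lemma is_ideal_ideal_gen: "is_ideal (ideal_gen S)"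
  unfolding is_ideal_def ideal_gen_def by (rule Modules.module.subspace_span[OF mult_module])

lemma is_ideal_cong:
  assumes "is_ideal I" "f - g \<in> I"
  shows "f \<in> I \<longleftrightarrow> g \<in> I"
proof
  assume "f \<in> I"
  from is_ideal_diff[OF assms(1) this assms(2)] show "g \<in> I" by simp
next
  assume "g \<in> I"
  from is_ideal_add[OF assms this] show "f \<in> I" by simp
qed

lemma homogeneous_idealD:
  "homogeneous_ideal I \<Longrightarrow> is_ideal I" "homogeneous_ideal I \<Longrightarrow> f \<in> I \<Longrightarrow> hom_component i f \<in> I"
  by (auto simp: homogeneous_ideal_def)

section \<open>Linear algebra modulo a subspace\<close>

text \<open>Representatives of a basis of the quotient \<open>N/K\<close>. The Hilbert function of \<open>R/I\<close> counts such bases,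
  and with them no quotient space has to be formed.\<close>

definition rel_basis ::
    "('k::field \<Rightarrow> 'b::ab_group_add \<Rightarrow> 'b) \<Rightarrow> 'b set \<Rightarrow> 'b set \<Rightarrow> nat \<Rightarrow> (nat \<Rightarrow> 'b) \<Rightarrow> bool" where
  "rel_basis s K N n b \<longleftrightarrow> (\<forall>i<n. b i \<in> N) \<and>
     (\<forall>h\<in>N. \<exists>c. h - (\<Sum>i<n. s (c i) (b i)) \<in> K) \<and>
     (\<forall>c. (\<Sum>i<n. s (c i) (b i)) \<in> K \<longrightarrow> (\<forall>i<n. c i = 0))"

context vector_space
begin

lemma finite_basis_exists:
  assumes "subspace K" "K \<subseteq> span T" "finite T"
  obtains B where "B \<subseteq> K" "independent B" "span B = K" "card B = dim K" "finite B"
proof -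
  obtain B where B: "B \<subseteq> K" "independent B" "K \<subseteq> span B" "card B = dim K"
    using basis_exists[of K] by blast
  moreover have "finite B"
    using independent_span_bound[of T B] B assms by blast
  moreover have "span B = K"
    using B assms by (simp add: span_subspace)
  ultimately show ?thesis using that by blast
qed

lemma rel_basis_exists:
  assumes K: "subspace K" and N: "subspace N" "K \<subseteq> N" "N \<subseteq> span T" "finite T"
  obtains b where "rel_basis scale K N (dim N - dim K) b" "dim K \<le> dim N"
proof -
  obtain B where B: "B \<subseteq> K" "independent B" "span B = K" "card B = dim K" "finite B"
    using finite_basis_exists[of K T] assms by blast
  obtain C where C: "B \<subseteq> C" "C \<subseteq> N" "independent C" "N \<subseteq> span C"
    using maximal_independent_subset_extend[of B N] B N by blast
  have finC: "finite C" using independent_span_bound[of T C] C assms by blast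
  have dimN: "dim N = card C" using C basis_card_eq_dim by metis
  define n where "n = dim N - dim K"
  have cardD: "card (C - B) = n"
    using C B finC by (simp add: n_def dimN card_Diff_subset)
  obtain b where b: "bij_betw b {..<n} (C - B)"
    using ex_bij_betw_nat_finite[of "C - B"] finC cardD by (auto simp: atLeast0LessThan)
  have spanC: "span C = N" using C N by (simp add: span_subspace)
  have "rel_basis scale K N n b"
    unfolding rel_basis_def
  proof (intro conjI allI ballI impI)
    show "b i \<in> N" if "i < n" for i
      using that b C by (auto simp: bij_betw_def)
    show "\<exists>c. h - (\<Sum>i<n. c i *s b i) \<in> K" if "h \<in> N" for h
    proof -
      from that spanC finC obtain u where u: "h = (\<Sum>v\<in>C. u v *s v)"
        by (auto simp: span_finite)
      have "h = (\<Sum>v\<in>C - B. u v *s v) + (\<Sum>v\<in>B. u v *s v)"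
        using C finC by (simp add: u sum.subset_diff)
      also have "(\<Sum>v\<in>C - B. u v *s v) = (\<Sum>i<n. u (b i) *s b i)"
        by (rule sum.reindex_bij_betw[OF b, symmetric])
      finally have "h - (\<Sum>i<n. u (b i) *s b i) = (\<Sum>v\<in>B. u v *s v)" by simp
      also have "\<dots> \<in> K" using B K by (auto intro: subspace_sum subspace_scale)
      finally show ?thesis by (intro exI[of _ "\<lambda>i. u (b i)"])
    qed
    show "c i = 0" if c: "(\<Sum>i<n. c i *s b i) \<in> K" and i: "i < n" for c i
    proof -
      from c B obtain u where u: "(\<Sum>i<n. c i *s b i) = (\<Sum>v\<in>B. u v *s v)"
        by (auto simp: span_finite)
      let ?d = "\<lambda>v. c (inv_into {..<n} b v)"
      have inv: "inv_into {..<n} b (b i) = i" if "i < n" for i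
        using b that by (auto simp: bij_betw_def)
      have "(\<Sum>v\<in>C - B. ?d v *s v) = (\<Sum>i<n. ?d (b i) *s b i)"
        by (rule sum.reindex_bij_betw[OF b, symmetric])
      also have "\<dots> = (\<Sum>v\<in>B. u v *s v)"
        by (simp add: inv u)
      finally have *: "(\<Sum>v\<in>C. (if v \<in> B then - u v else ?d v) *s v) = 0"
        using C finC B by (subst sum.subset_diff[of B]) (auto simp: sum_negf)
      have "b i \<in> C - B" using b i by (auto simp: bij_betw_def)
      then show ?thesis
        using independentD[OF C(3) finC order_refl *, of "b i"] i by (simp add: inv)
    qed
  qed
  moreover have "dim K \<le> dim N" using B C finC by (metis card_mono dimN)
  ultimately show ?thesis using that by (simp add: n_def)
qed

text \<open>Joined to a basis of \<open>K\<close>, the family stays independent, and it is a basis of \<open>N\<close> if there is no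
  room for more. The inequality and its equality case serve to compare two Hilbert functions.\<close>

lemma rel_independent_dim:
  assumes K: "subspace K" and N: "subspace N" "K \<subseteq> N" "N \<subseteq> span T" "finite T"
    and b: "\<And>i. i < n \<Longrightarrow> b i \<in> N"
    and ind: "\<And>c. (\<Sum>i<n. c i *s b i) \<in> K \<Longrightarrow> \<forall>i<n. c i = 0"
  shows "dim K + n \<le> dim N" "dim K + n = dim N \<Longrightarrow> rel_basis scale K N n b"
proof -
  obtain B where B: "B \<subseteq> K" "independent B" "span B = K" "card B = dim K" "finite B"
    using finite_basis_exists[of K T] assms by blast
  have inj: "inj_on b {..<n}"
  proof (rule inj_onI, rule ccontr)
    fix i k assume ik: "i \<in> {..<n}" "k \<in> {..<n}" "b i = b k" "i \<noteq> k"
    let ?c = "(\<lambda>l. 0 :: 'a)(i := 1, k := - 1)"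
    have "(\<Sum>l<n. ?c l *s b l) = (\<Sum>l\<in>{i, k}. ?c l *s b l)"
      using ik(1,2) by (intro sum.mono_neutral_right) auto
    also have "\<dots> = b i - b k" using ik(4) by simp
    also have "\<dots> \<in> K" using ik(3) subspace_0[OF K] by simp
    finally have "\<forall>l<n. ?c l = 0" by (rule ind)
    then have "?c i = 0" using ik(1) by simp
    then show False using ik(4) by simp
  qed
  have notK: "b i \<notin> K" if "i < n" for i
  proof
    assume "b i \<in> K"
    moreover have "(\<Sum>l<n. ((\<lambda>l. 0)(i := 1)) l *s b l) = (\<Sum>l\<in>{i}. ((\<lambda>l. 0)(i := 1)) l *s b l)"
      using that by (intro sum.mono_neutral_right) auto
    ultimately have "(\<Sum>l<n. ((\<lambda>l. 0)(i := 1)) l *s b l) \<in> K" by simp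
    from ind[OF this] that show False by auto
  qed
  define C where "C = B \<union> b ` {..<n}"
  have disj: "B \<inter> b ` {..<n} = {}" using B notK by auto
  have finC: "finite C" using B by (simp add: C_def)
  have cardC: "card C = dim K + n"
    unfolding C_def using B disj inj by (simp add: card_Un_disjoint card_image)
  have sumC: "(\<Sum>v\<in>C. u v *s v) = (\<Sum>v\<in>B. u v *s v) + (\<Sum>i<n. u (b i) *s b i)" for u
    unfolding C_def using B disj inj by (simp add: sum.union_disjoint sum.reindex)
  have indC: "independent C"
  proof (rule independent_if_scalars_zero[OF finC])
    fix u v assume u: "(\<Sum>x\<in>C. u x *s x) = 0" and v: "v \<in> C"
    have "(\<Sum>i<n. u (b i) *s b i) = - (\<Sum>v\<in>B. u v *s v)"
      using u sumC[of u] by (simp add: eq_neg_iff_add_eq_0 add.commute)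
    also have "\<dots> \<in> K"
      using B K by (intro subspace_neg subspace_sum subspace_scale) auto
    finally have z: "\<forall>i<n. u (b i) = 0" by (rule ind)
    then have "(\<Sum>v\<in>B. u v *s v) = 0" using u sumC[of u] by simp
    then have "\<forall>v\<in>B. u v = 0" using independentD[OF B(2) B(5) order_refl] by blast
    then show "u v = 0" using v z by (auto simp: C_def)
  qed
  have CN: "C \<subseteq> N" using B N b by (auto simp: C_def)
  obtain D where D: "C \<subseteq> D" "D \<subseteq> N" "independent D" "N \<subseteq> span D"
    using maximal_independent_subset_extend[OF CN indC] by blast
  have finD: "finite D" using independent_span_bound[of T D] D assms by blast
  have dimN: "dim N = card D" using D basis_card_eq_dim by metis
  show "dim K + n \<le> dim N"
    using card_mono[OF finD D(1)] by (simp add: cardC dimN)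
  assume eq: "dim K + n = dim N"
  have "C = D" using D finD eq cardC dimN by (intro card_subset_eq) auto
  then have spanC: "N = span C" using D N by (simp add: span_subspace)
  show "rel_basis scale K N n b"
    unfolding rel_basis_def
  proof (intro conjI allI ballI impI)
    show "b i \<in> N" if "i < n" for i using that b by blast
    show "c i = 0" if "(\<Sum>i<n. c i *s b i) \<in> K" "i < n" for c i using that ind by blast
    show "\<exists>c. h - (\<Sum>i<n. c i *s b i) \<in> K" if h: "h \<in> N" for h
    proof -
      from h finC obtain u where "h = (\<Sum>v\<in>C. u v *s v)"
        unfolding spanC by (auto simp: span_finite)
      then have "h - (\<Sum>i<n. u (b i) *s b i) = (\<Sum>v\<in>B. u v *s v)" by (simp add: sumC)
      also have "\<dots> \<in> K" using B K by (auto intro: subspace_sum subspace_scale)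
      finally show ?thesis by (intro exI[of _ "\<lambda>i. u (b i)"])
    qed
  qed
qed

lemma dim_subspace_mono:
  assumes "subspace K" "subspace N" "K \<subseteq> N" "N \<subseteq> span T" "finite T"
  shows "dim K \<le> dim N"
  using rel_basis_exists[OF assms] by metis

lemma dim_subspace_eq:
  assumes K: "subspace K" and N: "subspace N" "K \<subseteq> N" "N \<subseteq> span T" "finite T"
    and eq: "dim K = dim N"
  shows "K = N"
proof -
  have "rel_basis scale K N 0 undefined"
    using rel_independent_dim(2)[of K N T 0 undefined] K N eq by auto
  then have "N \<subseteq> K" by (auto simp: rel_basis_def)
  then show ?thesis using N by blast
qed

end

text \<open>If \<open>n' < n\<close>, the Gram matrix of the two bases has more columns than rows, so some nontrivial
  combination of the \<open>b i\<close> is orthogonal to all \<open>b' i\<close>. It then lies in the left radical \<open>K\<close>,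
  against independence modulo \<open>K\<close>.\<close>

lemma nondegenerate_pairing_codim_le:
  fixes s1 :: "'k::field \<Rightarrow> 'b::ab_group_add \<Rightarrow> 'b" and s2 :: "'k \<Rightarrow> 'c::ab_group_add \<Rightarrow> 'c"
    and \<beta> :: "'b \<Rightarrow> 'c \<Rightarrow> 'k"
  assumes vs: "vector_space s1" "vector_space s2"
    and lin1: "\<And>n c b y. \<beta> (\<Sum>i<(n::nat). s1 (c i) (b i)) y = (\<Sum>i<n. c i * \<beta> (b i) y)"
    and lin2: "\<And>n c b x. \<beta> x (\<Sum>i<(n::nat). s2 (c i) (b i)) = (\<Sum>i<n. c i * \<beta> x (b i))"
    and diff2: "\<And>x y z. \<beta> x (y - z) = \<beta> x y - \<beta> x z"
    and b: "rel_basis s1 K N n b" and b': "rel_basis s2 K' N' n' b'"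
    and sub: "Modules.module.subspace s1 N"
    and rad: "\<And>x. x \<in> N \<Longrightarrow> (\<And>y. y \<in> N' \<Longrightarrow> \<beta> x y = 0) \<Longrightarrow> x \<in> K"
    and rad': "\<And>x y. x \<in> N \<Longrightarrow> y \<in> K' \<Longrightarrow> \<beta> x y = 0"
  shows "n \<le> n'"
proof (rule ccontr)
  interpret v1: vector_space s1 by fact
  interpret v2: vector_space s2 by fact
  assume "\<not> n \<le> n'"
  then have less: "n' < n" by simp
  note b = b[unfolded rel_basis_def] and b' = b'[unfolded rel_basis_def]
  \<comment> \<open>Rows of zeros make the Gram matrix square, so that determinants apply.\<close>
  define A where "A = mat n n (\<lambda>(i, k). if i < n' then \<beta> (b k) (b' i) else 0)"
  have A: "A \<in> carrier_mat n n" by (simp add: A_def)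
  have "transpose_mat A *\<^sub>v unit_vec n (n - 1) = 0\<^sub>v n"
    by (rule eq_vecI) (use less in \<open>auto simp: A_def scalar_prod_def unit_vec_def intro!: sum.neutral\<close>)
  moreover have "unit_vec n (n - 1) \<noteq> (0\<^sub>v n :: 'k vec)" using less by simp
  ultimately have "det (transpose_mat A) = 0"
    using A by (subst det_0_iff_vec_prod_zero[of _ n]) (auto intro!: exI[of _ "unit_vec n (n - 1)"])
  then have "det A = 0" using A by (simp add: det_transpose)
  then obtain v where v: "v \<in> carrier_vec n" "v \<noteq> 0\<^sub>v n" "A *\<^sub>v v = 0\<^sub>v n"
    using det_0_iff_vec_prod_zero[OF A] by blast
  define x where "x = (\<Sum>k<n. s1 (v $ k) (b k))"
  have xN: "x \<in> N" unfolding x_def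
    using b by (intro v1.subspace_sum[OF sub] v1.subspace_scale[OF sub]) auto
  have xb': "\<beta> x (b' i) = 0" if "i < n'" for i
  proof -
    have "(A *\<^sub>v v) $ i = (\<Sum>k<n. \<beta> (b k) (b' i) * v $ k)"
      using A v(1) less that by (simp add: scalar_prod_def A_def atLeast0LessThan)
    then show ?thesis using v(3) less that by (simp add: x_def lin1 mult.commute)
  qed
  have "x \<in> K"
  proof (rule rad[OF xN])
    fix y assume "y \<in> N'"
    then obtain c where c: "y - (\<Sum>i<n'. s2 (c i) (b' i)) \<in> K'" using b' by blast
    have "\<beta> x y = \<beta> x (\<Sum>i<n'. s2 (c i) (b' i))"
      using rad'[OF xN c] by (simp add: diff2)
    then show "\<beta> x y = 0" by (simp add: lin2 xb')
  qed
  then have "\<forall>k<n. v $ k = 0" using b unfolding x_def by blast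
  then have "v = 0\<^sub>v n" using v by (intro eq_vecI) auto
  with v show False by simp
qed

section \<open>The contraction pairing\<close>

text \<open>Polynomials and divided power forms are both coefficient functions on exponent vectors, so the
  duality between \<open>R\<^sub>j\<close> and \<open>\<Gamma>\<^sub>j\<close> in their monomial bases is this symmetric form.\<close>

definition ip :: "('a \<Rightarrow>\<^sub>0 'k::field) \<Rightarrow> ('a \<Rightarrow>\<^sub>0 'k) \<Rightarrow> 'k" where
  "ip f g = (\<Sum>m\<in>Poly_Mapping.keys f. coef f m * coef g m)"

lemma ip_superset:
  assumes "finite A" "Poly_Mapping.keys f \<subseteq> A"
  shows "ip f g = (\<Sum>m\<in>A. coef f m * coef g m)"
  unfolding ip_def by (rule sum.mono_neutral_left) (use assms in \<open>auto simp: in_keys_iff\<close>)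

lemma ip_commute: "ip f g = ip g f"
  by (subst (1 2) ip_superset[of "Poly_Mapping.keys f \<union> Poly_Mapping.keys g"])
     (auto simp: mult.commute)

lemma ip_add_right: "ip f (g + h) = ip f g + ip f h"
  by (simp add: ip_def lookup_add algebra_simps sum.distrib)

lemma ip_scale_right: "ip f (scale_mpoly c g) = c * ip f g"
  by (simp add: ip_def sum_distrib_left algebra_simps)

lemma ip_add_left: "ip (f + g) h = ip f h + ip g h"
  by (simp add: ip_commute[of _ h] ip_add_right)

lemma ip_scale_left: "ip (scale_mpoly c f) g = c * ip f g"
  by (simp add: ip_commute[of _ g] ip_scale_right)

lemma ip_0 [simp]: "ip 0 f = 0" "ip f 0 = 0"
  by (simp_all add: ip_def)

lemma ip_diff_left: "ip (f - g) h = ip f h - ip g h"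
  using ip_add_left[of "f - g" g h] by simp

lemma ip_sum_left: "ip (sum f A) g = (\<Sum>x\<in>A. ip (f x) g)"
  by (induct A rule: infinite_finite_induct) (auto simp: ip_add_left)

lemma ip_single [simp]: "ip (Poly_Mapping.single m c) g = c * coef g m"
  by (subst ip_superset[of "{m}"]) auto

lemma ip_ext: "(\<And>g. ip g F = ip g G) \<Longrightarrow> F = G"
  using ip_single[of _ 1] by (metis mult_1 poly_mapping_eqI)

lemma ip_homog_neq:
  assumes "f \<in> homog i" "g \<in> homog j" "i \<noteq> j"
  shows "ip f g = 0"
  unfolding ip_def using assms
  by (intro sum.neutral) (auto dest: homogD)

lemma ip_homog_eq_0:
  assumes "F \<in> homog i" "\<And>g. g \<in> homog i \<Longrightarrow> ip g F = 0"
  shows "F = 0"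
proof (rule poly_mapping_eqI)
  fix m
  show "coef F m = coef 0 m"
    using assms(2)[OF homog_monom[of m i 1]] homogD[OF assms(1), of m] by auto
qed

lemma ip_mult_single_left:
  fixes h F :: "('v, 'k::field) mpoly"
  shows "ip (Poly_Mapping.single W 1 * h) F = (\<Sum>K\<in>Poly_Mapping.keys h. coef h K * coef F (K + W))"
proof -
  have "Poly_Mapping.single W 1 * h = Poly_Mapping.single W 1 * (\<Sum>K\<in>Poly_Mapping.keys h. Poly_Mapping.single K (coef h K))"
    by (simp add: sum_single_keys)
  also have "ip \<dots> F = (\<Sum>K\<in>Poly_Mapping.keys h. coef h K * coef F (K + W))"
    by (simp add: sum_distrib_left mult_single ip_sum_left add.commute[of W])
  finally show ?thesis .
qed

lemma coef_contract:
  "coef (contract h F) W = (\<Sum>K\<in>Poly_Mapping.keys h. coef h K * coef F (K + W))"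
proof -
  have "(\<Sum>U\<in>Poly_Mapping.keys F. coef (if \<forall>v. coef K v \<le> coef U v
      then Poly_Mapping.single (U - K) (coef h K * coef F U) else 0) W)
     = (\<Sum>U\<in>Poly_Mapping.keys F. if U = K + W then coef h K * coef F (K + W) else 0)" for K
  proof (intro sum.cong refl)
    fix U
    show "coef (if \<forall>v. coef K v \<le> coef U v
        then Poly_Mapping.single (U - K) (coef h K * coef F U) else 0) W
      = (if U = K + W then coef h K * coef F (K + W) else 0)"
    proof (cases "\<forall>v. coef K v \<le> coef U v")
      case True
      then have U: "U = K + (U - K)"
        by (intro poly_mapping_eqI) (simp add: lookup_add lookup_minus)
      then have *: "U - K = W \<longleftrightarrow> U = K + W"
        by (metis add_left_cancel)
      show ?thesis using True by (simp add: lookup_single when_def *)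
    next
      case False
      then have "U \<noteq> K + W" by (auto simp: lookup_add)
      then show ?thesis unfolding if_not_P[OF False] by simp
    qed
  qed
  moreover have "(\<Sum>U\<in>Poly_Mapping.keys F. if U = K + W then coef h K * coef F (K + W) else 0)
     = coef h K * coef F (K + W)" for K
    by (auto simp: in_keys_iff)
  ultimately show ?thesis
    by (simp add: contract_def lookup_sum)
qed

text \<open>This adjunction turns statements on contraction into statements on the bilinear forms
  \<open>(g, h) \<mapsto> F(g h)\<close>. It holds because \<open>x\<^sup>W\<close> pairs with \<open>h \<circ> F\<close> to the coefficient at \<open>W\<close>, which
  collects the products of coefficients of \<open>h\<close> and \<open>F\<close> at exponents that differ by \<open>W\<close>.\<close>

lemma ip_contract: "ip g (contract h F) = ip (g * h) F"
proof -
  have "ip (g * h) F = ip ((\<Sum>W\<in>Poly_Mapping.keys g. scale_mpoly (coef g W) (Poly_Mapping.single W 1)) * h) F"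
    by (simp add: mpoly_expand[symmetric])
  also have "\<dots> = (\<Sum>W\<in>Poly_Mapping.keys g. coef g W * ip (Poly_Mapping.single W 1 * h) F)"
    by (simp add: sum_distrib_right scale_mult_left ip_sum_left ip_scale_left)
  also have "\<dots> = ip g (contract h F)"
    by (simp add: ip_def[of g] coef_contract ip_mult_single_left)
  finally show ?thesis by simp
qed

lemma contract_eq_0_iff: "contract h F = 0 \<longleftrightarrow> (\<forall>g. ip (g * h) F = 0)"
proof
  assume "\<forall>g. ip (g * h) F = 0"
  then show "contract h F = 0" by (intro ip_ext) (simp add: ip_contract)
next
  assume "contract h F = 0"
  then show "\<forall>g. ip (g * h) F = 0" using ip_contract[of _ h F] by simp
qed

lemma contract_homog:
  assumes "h \<in> homog i" "F \<in> homog j" "i \<le> j"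
  shows "contract h F \<in> homog (j - i)"
proof (rule homogI)
  fix m assume m: "coef (contract h F) m \<noteq> 0"
  have "ip (Poly_Mapping.single m 1 * h) F \<noteq> 0"
    using m ip_contract[of "Poly_Mapping.single m 1" h F] by simp
  then have "mdeg m + i = j"
    using ip_homog_neq[OF homog_mult[OF homog_monom[OF refl] assms(1)] assms(2)] by blast
  then show "mdeg m = j - i" by simp
qed

lemma contract_homog_eq_0_iff:
  assumes h: "h \<in> homog i" and F: "F \<in> homog j" and ij: "i \<le> j"
  shows "contract h F = 0 \<longleftrightarrow> (\<forall>g\<in>homog (j - i). ip (g * h) F = 0)"
proof
  assume "contract h F = 0"
  then show "\<forall>g\<in>homog (j - i). ip (g * h) F = 0" by (simp add: contract_eq_0_iff)
next
  assume *: "\<forall>g\<in>homog (j - i). ip (g * h) F = 0"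
  show "contract h F = 0"
    using * by (intro ip_homog_eq_0[OF contract_homog[OF assms]]) (simp add: ip_contract)
qed

lemma contract_high_degree:
  assumes h: "h \<in> homog i" and F: "F \<in> homog j" and ij: "j < i"
  shows "contract h F = 0"
proof (rule poly_mapping_eqI)
  fix m
  have "ip (Poly_Mapping.single m 1 * h) F = 0"
    by (rule ip_homog_neq[OF homog_mult[OF homog_monom[OF refl] h] F]) (use ij in auto)
  then show "coef (contract h F) m = coef 0 m"
    using ip_contract[of "Poly_Mapping.single m 1" h F] by simp
qed

lemma contract_add: "contract (h + h') F = contract h F + contract h' F"
  by (rule ip_ext) (simp add: ip_contract ip_add_right distrib_left ip_add_left)

lemma contract_scale: "contract (scale_mpoly c h) F = scale_mpoly c (contract h F)"
  by (rule ip_ext) (simp add: ip_contract ip_scale_right scale_mult_right ip_scale_left)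

lemma contract_0 [simp]: "contract 0 F = 0"
  by (simp add: contract_def)

subsection \<open>Orthogonal complements\<close>

lemma dim_homog_mono:
  fixes K N :: "('v::finite, 'k::field) mpoly set"
  assumes "mp.subspace K" "mp.subspace N" "K \<subseteq> N" "N \<subseteq> homog i"
  shows "mp.dim K \<le> mp.dim N"
proof -
  obtain T :: "('v, 'k) mpoly set" where "finite T" "homog i \<subseteq> mp.span T"
    using homog_finite_span[of i] by blast
  then show ?thesis using mp.dim_subspace_mono[of K N T] assms by blast
qed

lemma dim_homog_eq:
  fixes K N :: "('v::finite, 'k::field) mpoly set"
  assumes "mp.subspace K" "mp.subspace N" "K \<subseteq> N" "N \<subseteq> homog i" "mp.dim K = mp.dim N"
  shows "K = N"
proof -
  obtain T :: "('v, 'k) mpoly set" where "finite T" "homog i \<subseteq> mp.span T"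
    using homog_finite_span[of i] by blast
  then show ?thesis using mp.dim_subspace_eq[of K N T] assms by blast
qed

lemma homog_rel_basis_exists:
  fixes K N :: "('v::finite, 'k::field) mpoly set"
  assumes "mp.subspace K" "mp.subspace N" "K \<subseteq> N" "N \<subseteq> homog i"
  obtains b where "rel_basis scale_mpoly K N (mp.dim N - mp.dim K) b"
proof -
  obtain T :: "('v, 'k) mpoly set" where "finite T" "homog i \<subseteq> mp.span T"
    using homog_finite_span[of i] by blast
  with assms have "N \<subseteq> mp.span T" by blast
  then show ?thesis
    using mp.rel_basis_exists[OF assms(1-3)] \<open>finite T\<close> that by metis
qed

text \<open>Row rank equals column rank. The symmetry of the Hilbert function of \<open>R/Ann F\<close> and the dimension of
  an orthogonal complement are both instances.\<close>

lemma pairing_codim_eq: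
  fixes \<beta> :: "('v::finite, 'k::field) mpoly \<Rightarrow> ('v, 'k) mpoly \<Rightarrow> 'k"
  assumes lin1: "\<And>x x' y. \<beta> (x + x') y = \<beta> x y + \<beta> x' y" "\<And>c x y. \<beta> (scale_mpoly c x) y = c * \<beta> x y"
    and lin2: "\<And>x y y'. \<beta> x (y + y') = \<beta> x y + \<beta> x y'" "\<And>c x y. \<beta> x (scale_mpoly c y) = c * \<beta> x y"
    and N: "mp.subspace K" "mp.subspace N" "K \<subseteq> N" "N \<subseteq> homog i"
    and N': "mp.subspace K'" "mp.subspace N'" "K' \<subseteq> N'" "N' \<subseteq> homog i'"
    and rad: "\<And>x. x \<in> N \<Longrightarrow> x \<in> K \<longleftrightarrow> (\<forall>y\<in>N'. \<beta> x y = 0)"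
    and rad': "\<And>y. y \<in> N' \<Longrightarrow> y \<in> K' \<longleftrightarrow> (\<forall>x\<in>N. \<beta> x y = 0)"
  shows "mp.dim N - mp.dim K = mp.dim N' - mp.dim K'"
proof -
  obtain b where b: "rel_basis scale_mpoly K N (mp.dim N - mp.dim K) b"
    using homog_rel_basis_exists[OF N] .
  obtain b' where b': "rel_basis scale_mpoly K' N' (mp.dim N' - mp.dim K') b'"
    using homog_rel_basis_exists[OF N'] .
  have z: "\<beta> 0 y = 0" "\<beta> x 0 = 0" for x y
    using lin1(2)[of 0 0 y] lin2(2)[of x 0 0] by simp_all
  have s1: "\<beta> (\<Sum>i<n. scale_mpoly (c i) (b i)) y = (\<Sum>i<n. c i * \<beta> (b i) y)" for n :: nat and c b y
    by (induct n) (auto simp: lin1 z)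
  have s2: "\<beta> x (\<Sum>i<n. scale_mpoly (c i) (b i)) = (\<Sum>i<n. c i * \<beta> x (b i))" for n :: nat and c b x
    by (induct n) (auto simp: lin2 z)
  have d1: "\<beta> (y - x) z = \<beta> y z - \<beta> x z" and d2: "\<beta> z (y - x) = \<beta> z y - \<beta> z x" for x y z
    using lin1(1)[of "y - x" x z] lin2(1)[of z "y - x" x] by simp_all
  show ?thesis
  proof (rule antisym)
    show "mp.dim N - mp.dim K \<le> mp.dim N' - mp.dim K'"
      by (rule nondegenerate_pairing_codim_le[of scale_mpoly scale_mpoly \<beta>, OF mp.vector_space_axioms mp.vector_space_axioms s1 s2 d2 b b' N(2)])
         (use rad rad' N(3) N'(3) in auto)
    show "mp.dim N' - mp.dim K' \<le> mp.dim N - mp.dim K"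
      by (rule nondegenerate_pairing_codim_le[of scale_mpoly scale_mpoly "\<lambda>x y. \<beta> y x", OF mp.vector_space_axioms mp.vector_space_axioms s2 s1 d1 b' b N'(2)])
         (use rad rad' N(3) N'(3) in auto)
  qed
qed

definition perp :: "nat \<Rightarrow> ('v::finite, 'k::field) mpoly set \<Rightarrow> ('v, 'k) mpoly set" where
  "perp i S = {f \<in> homog i. \<forall>g\<in>S. ip g f = 0}"

lemma perp_subspace: "mp.subspace (perp i S)"
  by (rule mp.subspaceI) (auto simp: perp_def ip_add_right ip_scale_right homog_add homog_scale)

lemma perp_subset_homog: "perp i S \<subseteq> homog i"
  by (auto simp: perp_def)

text \<open>\<open>S\<close> and its double complement have the same orthogonal complement, hence the same dimension.\<close>

lemma perp_perp:
  fixes S :: "('v::finite, 'k::field) mpoly set"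
  assumes S: "mp.subspace S" "S \<subseteq> homog i"
  shows "perp i (perp i S) = S"
proof -
  have dim0: "mp.dim {0 :: ('v, 'k) mpoly} = 0"
    using mp.dim_span_eq_card_independent[of "{}"] by (simp add: mp.independent_empty)
  have dim: "mp.dim S = mp.dim (homog i :: ('v, 'k) mpoly set) - mp.dim (perp i S)"
    if S: "mp.subspace S" "S \<subseteq> homog i" for S :: "('v, 'k) mpoly set"
  proof -
    have "mp.dim S - mp.dim {0 :: ('v, 'k) mpoly} = mp.dim (homog i :: ('v, 'k) mpoly set) - mp.dim (perp i S)"
    proof (rule pairing_codim_eq[of ip])
      show "x \<in> {0} \<longleftrightarrow> (\<forall>y\<in>homog i. ip x y = 0)" if "x \<in> S" for x
        using that S ip_homog_eq_0[of x i] by (auto simp: ip_commute)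
      show "y \<in> perp i S \<longleftrightarrow> (\<forall>x\<in>S. ip x y = 0)" if "y \<in> homog i" for y
        using that by (simp add: perp_def)
    qed (use S in \<open>auto simp: ip_add_left ip_add_right ip_scale_left ip_scale_right perp_subspace
        homog_subspace perp_subset_homog mp.subspace_0\<close>)
    then show ?thesis by (simp add: dim0)
  qed
  have sub: "T \<subseteq> perp i (perp i T)" if "T \<subseteq> homog i" for T :: "('v, 'k) mpoly set"
    using that by (auto simp: perp_def ip_commute)
  have "perp i (perp i (perp i S)) = perp i S"
  proof
    show "perp i S \<subseteq> perp i (perp i (perp i S))" by (rule sub[OF perp_subset_homog])
    show "perp i (perp i (perp i S)) \<subseteq> perp i S"
    proof
      fix f assume f: "f \<in> perp i (perp i (perp i S))"
      then have "\<forall>g\<in>perp i (perp i S). ip g f = 0"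
        by (simp add: perp_def[of i "perp i (perp i S)"])
      moreover have "f \<in> homog i" using f perp_subset_homog by blast
      ultimately show "f \<in> perp i S"
        using sub[OF S(2)] unfolding perp_def[of i S] by blast
    qed
  qed
  then have "mp.dim S = mp.dim (perp i (perp i S))"
    using dim[OF S] dim[OF perp_subspace perp_subset_homog, of "perp i S"] by simp
  from dim_homog_eq[OF S(1) perp_subspace sub[OF S(2)] perp_subset_homog this] show ?thesis by simp
qed

text \<open>The contraction of two forms of the same degree is a constant, namely their pairing.\<close>

lemma inverse_system_eq_perp:
  fixes I :: "('v::finite, 'k::field) mpoly set"
  assumes "is_ideal I"
  shows "inverse_system I j = perp j (I \<inter> homog j)"
proof -
  have "contract h F = 0 \<longleftrightarrow> ip h F = 0" if "F \<in> homog j" "h \<in> homog j" for h F :: "('v, 'k) mpoly"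
  proof -
    have "contract h F = 0 \<longleftrightarrow> (\<forall>g\<in>homog 0. ip (g * h) F = 0)"
      using contract_homog_eq_0_iff[OF that(2,1)] by simp
    also have "\<dots> \<longleftrightarrow> ip h F = 0"
      using bspec[of "homog 0" "\<lambda>g. ip (g * h) F = 0", OF _ homog_1]
      by (auto simp: homog_0_iff scale_mult_left ip_scale_left)
    finally show ?thesis .
  qed
  then show ?thesis by (auto simp: inverse_system_def perp_def)
qed

section \<open>Eigenvectors modulo an ideal\<close>

text \<open>Since \<open>l\<close> is injective modulo \<open>I\<close> and \<open>f N\<close> is contained in \<open>l N\<close> modulo \<open>I\<close>, the quotient \<open>f/l\<close> is
  an endomorphism of \<open>N/I\<close>. Its characteristic polynomial has a root.\<close>

lemma eigenvector_mod_ideal_exists: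
  fixes I N :: "('v::finite, 'k::alg_closed_field) mpoly set"
  assumes I: "is_ideal I"
    and l: "\<And>g. l * g \<in> I \<Longrightarrow> g \<in> I"
    and N: "mp.subspace N" "N \<subseteq> homog e" "\<not> N \<subseteq> I"
    and stable: "\<And>h. h \<in> N \<Longrightarrow> \<exists>h'\<in>N. f * h - l * h' \<in> I"
  obtains c h where "h \<in> N" "h \<notin> I" "f * h - scale_mpoly c (l * h) \<in> I"
proof -
  note subI = is_ideal_subspace[OF I]
  define K where "K = I \<inter> N"
  have K: "mp.subspace K" "K \<subseteq> N" using N subI by (auto simp: K_def mp.subspace_inter)
  define n where "n = mp.dim N - mp.dim K"
  obtain b where b: "rel_basis scale_mpoly K N n b"
    using homog_rel_basis_exists[OF K(1) N(1) K(2) N(2)] by (auto simp: n_def)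
  have bN: "b i \<in> N" if "i < n" for i using b that by (auto simp: rel_basis_def)
  have n0: "n \<noteq> 0"
  proof
    assume "n = 0"
    then have "N \<subseteq> K" using b by (auto simp: rel_basis_def)
    then show False using N by (auto simp: K_def)
  qed
  have "\<exists>c. f * b i - l * (\<Sum>k<n. scale_mpoly (c k) (b k)) \<in> I" if i: "i < n" for i
  proof -
    obtain h' where h': "h' \<in> N" "f * b i - l * h' \<in> I" using stable[OF bN[OF i]] by blast
    obtain c where "h' - (\<Sum>k<n. scale_mpoly (c k) (b k)) \<in> K"
      using b h' by (auto simp: rel_basis_def)
    then have "l * (h' - (\<Sum>k<n. scale_mpoly (c k) (b k))) \<in> I"
      using is_ideal_mult[OF I] by (auto simp: K_def)
    from is_ideal_add[OF I h'(2) this] show ?thesis by (auto simp: algebra_simps)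
  qed
  then obtain M where M: "\<And>i. i < n \<Longrightarrow> f * b i - l * (\<Sum>k<n. scale_mpoly (M i k) (b k)) \<in> I"
    by metis
  define A where "A = mat n n (\<lambda>(k, i). M i k)"
  have A: "A \<in> carrier_mat n n" by (simp add: A_def)
  have "\<exists>x. poly (char_poly A) x = 0"
    using degree_monic_char_poly[OF A] n0 alg_closed_imp_poly_has_root by force
  then obtain c where "eigenvalue A c" using eigenvalue_root_char_poly[OF A] by blast
  then obtain v where v: "v \<in> carrier_vec n" "v \<noteq> 0\<^sub>v n" "A *\<^sub>v v = c \<cdot>\<^sub>v v"
    using A by (auto simp: eigenvalue_def eigenvector_def)
  define h where "h = (\<Sum>i<n. scale_mpoly (v $ i) (b i))"
  have hN: "h \<in> N" unfolding h_def
    using bN by (intro mp.subspace_sum[OF N(1)] mp.subspace_scale[OF N(1)]) auto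
  have hI: "h \<notin> I"
  proof
    assume "h \<in> I"
    then have "\<forall>i<n. v $ i = 0"
      using b hN unfolding h_def rel_basis_def K_def by blast
    then have "v = 0\<^sub>v n" using v by (intro eq_vecI) auto
    with v show False by simp
  qed
  have Av: "(\<Sum>i<n. v $ i * M i k) = c * v $ k" if "k < n" for k
  proof -
    have "(A *\<^sub>v v) $ k = (\<Sum>i<n. v $ i * M i k)"
      using A v(1) that by (simp add: scalar_prod_def A_def atLeast0LessThan mult.commute)
    then show ?thesis using v that by simp
  qed
  have "(\<Sum>i<n. scale_mpoly (v $ i) (f * b i - l * (\<Sum>k<n. scale_mpoly (M i k) (b k)))) \<in> I"
    using M by (intro is_ideal_sum[OF I] is_ideal_scale[OF I]) auto
  also have "(\<Sum>i<n. scale_mpoly (v $ i) (f * b i - l * (\<Sum>k<n. scale_mpoly (M i k) (b k))))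
    = f * h - l * (\<Sum>i<n. \<Sum>k<n. scale_mpoly (v $ i * M i k) (b k))"
    by (simp add: h_def mp.scale_right_diff_distrib sum_subtractf sum_distrib_left
        scale_mult_right mp.scale_sum_right)
  also have "(\<Sum>i<n. \<Sum>k<n. scale_mpoly (v $ i * M i k) (b k)) = (\<Sum>k<n. scale_mpoly (c * v $ k) (b k))"
    by (subst sum.swap) (simp add: mp.scale_sum_left[symmetric] Av)
  also have "\<dots> = scale_mpoly c h"
    by (simp add: h_def mp.scale_sum_right)
  finally have "f * h - scale_mpoly c (l * h) \<in> I" by (simp add: scale_mult_right)
  with that hN hI show ?thesis by blast
qed

text \<open>The endomorphisms \<open>x\<^sub>w/l\<close> commute, so the eigenspaces of one are stable under all. On a stable
  subspace of minimal dimension among those not contained in \<open>I\<close>, each of them is therefore a scalar.\<close>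

lemma common_eigenvector_mod_ideal_exists:
  fixes I N :: "('v::finite, 'k::alg_closed_field) mpoly set"
  assumes I: "is_ideal I"
    and l: "\<And>g. l * g \<in> I \<Longrightarrow> g \<in> I"
    and N: "mp.subspace N" "N \<subseteq> homog e" "\<not> N \<subseteq> I" "I \<inter> homog e \<subseteq> N"
    and stable: "\<And>h w. h \<in> N \<Longrightarrow> \<exists>h'\<in>N. Var w * h - l * h' \<in> I"
  obtains a h where "h \<in> N" "h \<notin> I" "\<And>w. Var w * h - scale_mpoly (a w) (l * h) \<in> I"
proof -
  note subI = is_ideal_subspace[OF I]
  define P where "P M \<longleftrightarrow> mp.subspace M \<and> M \<subseteq> N \<and> \<not> M \<subseteq> I \<and>
    (\<forall>h\<in>M. \<forall>w. \<exists>h'\<in>M. Var w * h - l * h' \<in> I)" for M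
  have "P N" using N stable by (auto simp: P_def)
  then obtain M where M: "P M" and min: "\<And>M'. P M' \<Longrightarrow> mp.dim M \<le> mp.dim M'"
    using ex_has_least_nat[of P N mp.dim] by blast
  have M': "mp.subspace M" "M \<subseteq> homog e" "\<not> M \<subseteq> I" "M \<subseteq> N"
    using M N by (auto simp: P_def)
  have stM: "\<exists>h'\<in>M. Var w * h - l * h' \<in> I" if "h \<in> M" for h w
    using M that by (auto simp: P_def)
  have "\<exists>c. \<forall>h\<in>M. Var w * h - scale_mpoly c (l * h) \<in> I" for w
  proof -
    obtain c h where h: "h \<in> M" "h \<notin> I" "Var w * h - scale_mpoly c (l * h) \<in> I"
      using eigenvector_mod_ideal_exists[where f = "Var w" and l = l, OF I l M'(1-3) stM] by metis
    define E where "E = {h \<in> M. Var w * h - scale_mpoly c (l * h) \<in> I}"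
    have subE: "mp.subspace E"
    proof (rule mp.subspaceI)
      show "0 \<in> E" using mp.subspace_0[OF M'(1)] is_ideal_0[OF I] by (simp add: E_def)
      show "x + y \<in> E" if "x \<in> E" "y \<in> E" for x y
      proof -
        have "Var w * (x + y) - scale_mpoly c (l * (x + y))
            = (Var w * x - scale_mpoly c (l * x)) + (Var w * y - scale_mpoly c (l * y))"
          by (simp add: algebra_simps mp.scale_right_distrib)
        then show ?thesis using that mp.subspace_add[OF M'(1)] is_ideal_add[OF I] by (simp add: E_def)
      qed
      show "scale_mpoly d x \<in> E" if "x \<in> E" for x d
      proof -
        have "Var w * scale_mpoly d x - scale_mpoly c (l * scale_mpoly d x)
            = scale_mpoly d (Var w * x - scale_mpoly c (l * x))"
          by (simp add: scale_mult_right mp.scale_right_diff_distrib mp.scale_left_commute)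
        then show ?thesis using that mp.subspace_scale[OF M'(1)] is_ideal_scale[OF I] by (simp add: E_def)
      qed
    qed
    have "P E"
      unfolding P_def
    proof (intro conjI ballI allI)
      show "\<not> E \<subseteq> I" using h by (auto simp: E_def)
      show "E \<subseteq> N" using M' by (auto simp: E_def)
      fix x u assume x: "x \<in> E"
      then obtain y where y: "y \<in> M" "Var u * x - l * y \<in> I" using stM by (auto simp: E_def)
      have "Var u * (Var w * x - scale_mpoly c (l * x)) \<in> I"
        using x is_ideal_mult[OF I] by (auto simp: E_def)
      moreover have "Var w * (Var u * x - l * y) - scale_mpoly c (l * (Var u * x - l * y)) \<in> I"
        by (intro is_ideal_diff[OF I] is_ideal_scale[OF I] is_ideal_mult[OF I] y)
      ultimately have "Var u * (Var w * x - scale_mpoly c (l * x))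
         - (Var w * (Var u * x - l * y) - scale_mpoly c (l * (Var u * x - l * y))) \<in> I"
        by (rule is_ideal_diff[OF I])
      also have "Var u * (Var w * x - scale_mpoly c (l * x))
         - (Var w * (Var u * x - l * y) - scale_mpoly c (l * (Var u * x - l * y)))
         = l * (Var w * y - scale_mpoly c (l * y))"
        by (simp add: scale_mpoly_def algebra_simps)
      finally have "Var w * y - scale_mpoly c (l * y) \<in> I" by (rule l)
      with y show "\<exists>y\<in>E. Var u * x - l * y \<in> I" by (auto simp: E_def)
    qed (use subE in auto)
    then have "mp.dim M \<le> mp.dim E" by (rule min)
    moreover have "E \<subseteq> M" by (auto simp: E_def)
    ultimately have "E = M"
      using dim_homog_mono[OF subE M'(1) _ M'(2)] dim_homog_eq[OF subE M'(1) _ M'(2)] by force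
    then show ?thesis by (auto simp: E_def)
  qed
  then obtain a where "\<And>w h. h \<in> M \<Longrightarrow> Var w * h - scale_mpoly (a w) (l * h) \<in> I"
    by metis
  with M' that show ?thesis by blast
qed

text \<open>With \<open>x\<^sub>w h = a\<^sub>w l h\<close> in \<open>R/I\<close>, every monomial of degree \<open>d\<close> multiplies \<open>h\<close> by its value at \<open>a\<close>, up
  to the factor \<open>l\<^sup>d\<close>.\<close>

lemma eigenvector_eval:
  fixes I :: "('v::finite, 'k::field) mpoly set" and g h l :: "('v, 'k) mpoly"
  assumes I: "is_ideal I"
    and h: "\<And>w. Var w * h - scale_mpoly (a w) (l * h) \<in> I"
  shows "g \<in> homog d \<Longrightarrow> g * h - scale_mpoly (eval_mpoly g a) (l ^ d * h) \<in> I"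
proof (induct d arbitrary: g)
  case 0
  then obtain c where "g = scale_mpoly c 1" by (auto simp: homog_0_iff)
  then show ?case using is_ideal_0[OF I] by (simp add: scale_mult_left)
next
  case (Suc d)
  let ?S = "{g. g * h - scale_mpoly (eval_mpoly g a) (l ^ Suc d * h) \<in> I}"
  have S: "mp.subspace ?S"
  proof (rule mp.subspaceI; clarsimp)
    show "0 \<in> I" by (rule is_ideal_0[OF I])
    fix x y assume "x * h - scale_mpoly (eval_mpoly x a) (l * l ^ d * h) \<in> I"
      "y * h - scale_mpoly (eval_mpoly y a) (l * l ^ d * h) \<in> I"
    from is_ideal_add[OF I this]
    show "(x + y) * h - scale_mpoly (eval_mpoly (x + y) a) (l * l ^ d * h) \<in> I"
      by (simp add: eval_add mp.scale_left_distrib algebra_simps)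
  next
    fix c x assume "x * h - scale_mpoly (eval_mpoly x a) (l * l ^ d * h) \<in> I"
    from is_ideal_scale[OF I this, of c]
    show "scale_mpoly c x * h - scale_mpoly (c * eval_mpoly x a) (l * l ^ d * h) \<in> I"
      by (simp add: mp.scale_right_diff_distrib scale_mult_left)
  qed
  have "g \<in> ?S"
  proof (rule homog_Suc_induct[OF Suc.prems S])
    fix v :: 'v and f :: "('v, 'k) mpoly" assume f: "f \<in> homog d"
    have "Var v * (f * h - scale_mpoly (eval_mpoly f a) (l ^ d * h))
      + scale_mpoly (eval_mpoly f a) (l ^ d * (Var v * h - scale_mpoly (a v) (l * h))) \<in> I"
      by (intro is_ideal_add[OF I] is_ideal_scale[OF I] is_ideal_mult[OF I] h Suc.hyps f)
    also have "Var v * (f * h - scale_mpoly (eval_mpoly f a) (l ^ d * h))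
      + scale_mpoly (eval_mpoly f a) (l ^ d * (Var v * h - scale_mpoly (a v) (l * h)))
      = (Var v * f) * h - scale_mpoly (eval_mpoly (Var v * f) a) (l ^ Suc d * h)"
      by (simp add: eval_mult scale_mult_right scale_mult_left mp.scale_right_diff_distrib
          algebra_simps)
    finally show "Var v * f \<in> ?S" by simp
  qed
  then show ?case by simp
qed

section \<open>A linear form that is regular on the coordinate ring\<close>

text \<open>Over a finite field \<open>1 + \<Prod>(X - c)\<close> has no root.\<close>

lemma infinite_UNIV_alg_closed: "infinite (UNIV :: 'k::alg_closed_field set)"
proof
  assume fin: "finite (UNIV :: 'k set)"
  define p where "p = (\<Prod>x\<in>(UNIV :: 'k set). [:- x, 1:])"
  have "degree p = card (UNIV :: 'k set)"
    unfolding p_def by (subst degree_prod_eq_sum_degree) auto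
  then have deg: "degree p > 0" using fin by (simp add: card_gt_0_iff)
  then have "degree (p + 1) > 0" by (simp add: degree_add_eq_left)
  then obtain c where "poly (p + 1) c = 0" using alg_closed_imp_poly_has_root by blast
  moreover have "poly p c = 0" unfolding p_def poly_prod using fin by (auto intro!: prod_zero)
  ultimately show False by simp
qed

text \<open>If \<open>w\<close> avoids all but one of the hyperplanes and \<open>w'\<close> avoids the last one, then each hyperplane
  contains \<open>w + c w'\<close> for at most one scalar \<open>c\<close>.\<close>

lemma avoid_hyperplanes:
  fixes \<phi> :: "'i \<Rightarrow> ('v, 'k::field) mpoly \<Rightarrow> 'k"
  assumes inf: "infinite (UNIV :: 'k set)" and W: "mp.subspace W"
    and lin: "\<And>i x y c. \<phi> i (x + scale_mpoly c y) = \<phi> i x + c * \<phi> i y"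
    and A: "finite A" "\<And>i. i \<in> A \<Longrightarrow> \<exists>w\<in>W. \<phi> i w \<noteq> 0"
  shows "\<exists>w\<in>W. \<forall>i\<in>A. \<phi> i w \<noteq> 0"
  using A
proof (induct A)
  case empty
  then show ?case using mp.subspace_0[OF W] by auto
next
  case (insert k A)
  then obtain w w' where w: "w \<in> W" "\<forall>i\<in>A. \<phi> i w \<noteq> 0" and w': "w' \<in> W" "\<phi> k w' \<noteq> 0"
    by (metis insertCI)
  define bad where "bad = (\<lambda>i. - \<phi> i w / \<phi> i w') ` insert k A"
  have "finite bad" using insert by (simp add: bad_def)
  then obtain c where c: "c \<notin> bad" using ex_new_if_finite[OF inf] by blast
  have "\<phi> i (w + scale_mpoly c w') \<noteq> 0" if i: "i \<in> insert k A" for i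
  proof (cases "\<phi> i w' = 0")
    case True
    then show ?thesis using i w w' by (auto simp: lin)
  next
    case False
    have "c \<noteq> - \<phi> i w / \<phi> i w'" using c i by (auto simp: bad_def)
    then show ?thesis using False by (auto simp: lin field_simps add_eq_0_iff)
  qed
  moreover have "w + scale_mpoly c w' \<in> W"
    using w w' by (intro mp.subspace_add[OF W] mp.subspace_scale[OF W])
  ultimately show ?case by blast
qed

lemma hom_component_sum:
  "hom_component i (sum f A) = (\<Sum>x\<in>A. hom_component i (f x))"
  by (rule poly_mapping_eqI) (simp add: coef_hom_component lookup_sum)

lemma hom_component_mult:
  assumes f: "f \<in> homog i"
  shows "hom_component (i + d) (f * g) = f * hom_component d g"
proof -
  obtain B where B: "g = (\<Sum>k<B. hom_component k g)" using sum_hom_components by blast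
  define G where "G = (\<lambda>k. hom_component k g)"
  have G: "G k \<in> homog k" for k unfolding G_def by (rule homog_hom_component)
  have g: "g = (\<Sum>k<B. G k)" using B by (simp add: G_def)
  have "hom_component (i + d) (f * g) = (\<Sum>k<B. hom_component (i + d) (f * G k))"
    unfolding g sum_distrib_left by (rule hom_component_sum)
  also have "\<dots> = (\<Sum>k<B. f * hom_component d (G k))"
    by (intro sum.cong refl) (auto simp: hom_component_homog[OF homog_mult[OF f G]] hom_component_homog[OF G])
  also have "\<dots> = f * hom_component d g"
    unfolding g hom_component_sum by (simp add: sum_distrib_left)
  finally show ?thesis .
qed

lemma homogeneous_ideal_ext:
  assumes "homogeneous_ideal I" "f \<notin> I"
  obtains d where "hom_component d f \<notin> I"
proof -
  have I: "is_ideal I" using assms homogeneous_idealD by blast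
  obtain B where B: "f = (\<Sum>k<B. hom_component k f)" using sum_hom_components by blast
  have "\<exists>d. hom_component d f \<notin> I"
  proof (rule ccontr)
    assume "\<nexists>d. hom_component d f \<notin> I"
    then have "(\<Sum>k<B. hom_component k f) \<in> I" by (intro is_ideal_sum[OF I]) auto
    with B assms show False by simp
  qed
  then show ?thesis using that by blast
qed

definition regular_on :: "('v::finite, 'k::field) mpoly set \<Rightarrow> ('v, 'k) mpoly \<Rightarrow> bool" where
  "regular_on I l \<longleftrightarrow> l \<in> homog 1 \<and> (\<forall>g. l * g \<in> I \<longrightarrow> g \<in> I)"

lemma regular_on_power:
  assumes "regular_on I l" "l ^ n * g \<in> I"
  shows "g \<in> I"
  using assms by (induct n) (auto simp: regular_on_def mult.assoc)

lemma regular_on_scaled_power: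
  assumes I: "is_ideal I" and l: "regular_on I l" and h: "h \<notin> I"
  shows "scale_mpoly c (l ^ n * h) \<in> I \<longleftrightarrow> c = 0"
proof
  assume *: "scale_mpoly c (l ^ n * h) \<in> I"
  show "c = 0"
  proof (rule ccontr)
    assume "c \<noteq> 0"
    then have "l ^ n * h \<in> I" using is_ideal_scale[OF I *, of "1 / c"] by simp
    then show False using regular_on_power[OF l] h by blast
  qed
qed (simp add: is_ideal_0[OF I])

text \<open>The forms that annihilate a common eigenvector in \<open>R/I\<close> are those in the prime ideal of the point of
  eigenvalues.\<close>

lemma eigenvector_mult_iff:
  assumes I: "is_ideal I" and l: "regular_on I l" and h: "h \<notin> I"
    and ev: "\<And>w. Var w * h - scale_mpoly (a w) (l * h) \<in> I"
    and g: "g \<in> homog d"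
  shows "g * h \<in> I \<longleftrightarrow> eval_mpoly g a = 0"
  using is_ideal_cong[OF I eigenvector_eval[OF I ev g]] regular_on_scaled_power[OF I l h] by simp

text \<open>A form in \<open>J \<subseteq> I\<close> annihilates \<open>h\<close> in \<open>R/I\<close>, so it vanishes at \<open>a\<close>. Applied to \<open>l\<close> itself, the
  eigenvector property says \<open>l h = l(a) l h\<close>, which normalizes the representative \<open>a\<close>.\<close>

lemma eigenvalues_zero:
  assumes I: "is_ideal I" and l: "regular_on I l" and h: "h \<notin> I"
    and ev: "\<And>w. Var w * h - scale_mpoly (a w) (l * h) \<in> I"
    and J: "homogeneous_ideal J" "J \<subseteq> I"
  shows "eval_mpoly l a = 1" "a \<in> zeros J"
proof -
  have l1: "l \<in> homog 1" using l by (simp add: regular_on_def)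
  from eigenvector_eval[OF I ev l1] have "scale_mpoly (1 - eval_mpoly l a) (l ^ 1 * h) \<in> I"
    by (simp add: mp.scale_left_diff_distrib)
  then have "1 - eval_mpoly l a = 0" by (simp only: regular_on_scaled_power[OF I l h])
  then show la: "eval_mpoly l a = 1" by simp
  have "a \<noteq> (\<lambda>_. 0)"
  proof
    assume "a = (\<lambda>_. 0)"
    then have "eval_mpoly l a = 0 ^ 1 * eval_mpoly l a"
      using eval_homog_scaled[OF l1, of 0 a] by simp
    with la show False by simp
  qed
  moreover have "eval_mpoly g a = 0" if g: "g \<in> J" for g
  proof -
    have "eval_mpoly (hom_component k g) a = 0" for k
      using eigenvector_mult_iff[OF I l h ev homog_hom_component, of k g]
        is_ideal_mult(2)[OF I, of "hom_component k g" h] homogeneous_idealD(2)[OF J(1) g] J by blast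
    moreover obtain B where "g = (\<Sum>k<B. hom_component k g)" using sum_hom_components by blast
    ultimately show ?thesis by (metis eval_sum sum.neutral)
  qed
  ultimately show "a \<in> zeros J" by (simp add: zeros_def)
qed

text \<open>Multiplication by \<open>l\<close> embeds \<open>(R/I)\<^sub>i\<close> in \<open>(R/I)\<^sub>i\<^sub>+\<^sub>1\<close>, and it is onto if the dimensions agree.\<close>

lemma hilbert_fun_regular:
  fixes I :: "('v::finite, 'k::field) mpoly set"
  assumes I: "is_ideal I" and l: "regular_on I l"
  shows "hilbert_fun I i \<le> hilbert_fun I (Suc i)"
    and "hilbert_fun I i = hilbert_fun I (Suc i) \<Longrightarrow> f \<in> homog (Suc i) \<Longrightarrow> \<exists>g\<in>homog i. f - l * g \<in> I"
proof -
  note dm = dim_mpoly_def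
  have sub: "mp.subspace (I \<inter> homog k)" for k
    using is_ideal_subspace[OF I] homog_subspace by (rule mp.subspace_inter)
  define n where "n = hilbert_fun I i"
  obtain b where b: "rel_basis scale_mpoly (I \<inter> homog i) (homog i) n b"
    using homog_rel_basis_exists[OF sub homog_subspace, of i i]
    by (auto simp: n_def hilbert_fun_def dm)
  obtain T :: "('v, 'k) mpoly set" where T: "finite T" "homog (Suc i) \<subseteq> mp.span T"
    using homog_finite_span by blast
  have lb: "l * b k \<in> homog (Suc i)" if "k < n" for k
    using homog_mult[of l 1 "b k" i] b l that by (auto simp: rel_basis_def regular_on_def)
  have sum: "(\<Sum>k<n. scale_mpoly (c k) (l * b k)) = l * (\<Sum>k<n. scale_mpoly (c k) (b k))" for c
    by (simp add: sum_distrib_left scale_mult_right)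
  have bh: "(\<Sum>k<n. scale_mpoly (c k) (b k)) \<in> homog i" for c
    using b by (intro homog_sum homog_scale) (auto simp: rel_basis_def)
  have ind: "\<forall>k<n. c k = 0" if "(\<Sum>k<n. scale_mpoly (c k) (l * b k)) \<in> I \<inter> homog (Suc i)" for c
  proof -
    from that l have "(\<Sum>k<n. scale_mpoly (c k) (b k)) \<in> I" by (auto simp: sum regular_on_def)
    then show ?thesis using b bh by (auto simp: rel_basis_def)
  qed
  have rid1: "mp.dim (I \<inter> homog (Suc i)) + n \<le> mp.dim (homog (Suc i) :: ('v, 'k) mpoly set)"
    by (rule mp.rel_independent_dim(1)[OF sub homog_subspace Int_lower2 T(2,1)]) (erule lb, erule ind)
  have rid2: "rel_basis scale_mpoly (I \<inter> homog (Suc i)) (homog (Suc i)) n (\<lambda>k. l * b k)"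
    if "mp.dim (I \<inter> homog (Suc i)) + n = mp.dim (homog (Suc i) :: ('v, 'k) mpoly set)"
    by (rule mp.rel_independent_dim(2)[OF sub homog_subspace Int_lower2 T(2,1) _ _ that]) (erule lb, erule ind)
  from rid1 show "hilbert_fun I i \<le> hilbert_fun I (Suc i)"
    unfolding n_def[symmetric] by (simp add: hilbert_fun_def dm)
  assume eq: "hilbert_fun I i = hilbert_fun I (Suc i)" and f: "f \<in> homog (Suc i)"
  have "mp.dim (I \<inter> homog (Suc i)) \<le> mp.dim (homog (Suc i) :: ('v, 'k) mpoly set)"
    using rid1 by simp
  then have "mp.dim (I \<inter> homog (Suc i)) + n = mp.dim (homog (Suc i) :: ('v, 'k) mpoly set)"
    unfolding n_def eq by (simp add: hilbert_fun_def dm)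
  from rid2[OF this] f obtain c where "f - (\<Sum>k<n. scale_mpoly (c k) (l * b k)) \<in> I"
    by (auto simp: rel_basis_def)
  then show "\<exists>g\<in>homog i. f - l * g \<in> I" using bh by (auto simp: sum)
qed

lemma bounded_mono_nat_stalls:
  fixes H :: "nat \<Rightarrow> nat"
  assumes mono: "\<And>i. H i \<le> H (Suc i)" and bound: "\<And>i. i \<ge> M \<Longrightarrow> H i \<le> s"
  obtains e where "e \<ge> M" "H e = H (Suc e)"
proof -
  have "\<exists>e\<ge>M. H e = H (Suc e)"
  proof (rule ccontr)
    assume "\<not> (\<exists>e\<ge>M. H e = H (Suc e))"
    then have less: "H e < H (Suc e)" if "e \<ge> M" for e
      using that mono[of e] by (metis le_neq_implies_less)
    have "n \<le> H (M + n)" for n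
      by (induct n) (use less in \<open>auto simp: Suc_le_eq intro: le_less_trans\<close>)
    from this[of "Suc s"] bound[of "M + Suc s"] show False by simp
  qed
  then show ?thesis using that by blast
qed

lemma Var_power: "Var v ^ n = Poly_Mapping.single (Poly_Mapping.single v n) 1"
  by (induct n) (auto simp: mult_single single_add[symmetric])

text \<open>If \<open>x\<^sub>v\<^sup>n\<^sup>(\<^sup>v\<^sup>)\<close> kills \<open>f\<close> in \<open>R/I\<close> for every \<open>v\<close>, then so does every monomial of degree \<open>\<Sum>n(v)\<close>,
  since it has some exponent at least \<open>n(v)\<close>. Saturation then puts \<open>f\<close> in \<open>I\<close>.\<close>

lemma saturated_variable:
  fixes I :: "('v::finite, 'k::field) mpoly set"
  assumes I: "is_ideal I" "saturated I" and f: "f \<notin> I"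
  obtains v where "\<And>n. Var v ^ n * f \<notin> I"
proof -
  have "\<exists>v. \<forall>n. Var v ^ n * f \<notin> I"
  proof (rule ccontr)
    assume "\<nexists>v. \<forall>n. Var v ^ n * f \<notin> I"
    then obtain n where n: "\<And>v. Var v ^ n v * f \<in> I" by metis
    define N where "N = (\<Sum>v\<in>UNIV. n v)"
    have "g * f \<in> I" if g: "g \<in> homog N" for g
    proof -
      have mono: "Poly_Mapping.single m 1 * f \<in> I" if m: "mdeg m = N" for m
      proof -
        have "\<exists>v. n v \<le> coef m v"
        proof (rule ccontr)
          assume "\<nexists>v. n v \<le> coef m v"
          then have "(\<Sum>v\<in>UNIV. coef m v) < (\<Sum>v\<in>UNIV. n v)"
            by (intro sum_strict_mono) (auto simp: not_le)
          then show False using m by (simp add: mdeg_def N_def)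
        qed
        then obtain v where v: "n v \<le> coef m v" ..
        have "m = (m - Poly_Mapping.single v (n v)) + Poly_Mapping.single v (n v)"
          by (rule poly_mapping_eqI) (use v in \<open>auto simp: lookup_add lookup_minus lookup_single when_def\<close>)
        then have "(Poly_Mapping.single m 1 :: ('v, 'k) mpoly)
            = Poly_Mapping.single (m - Poly_Mapping.single v (n v)) 1 * Var v ^ n v"
          unfolding Var_power mult_single by simp
        then show ?thesis
          using is_ideal_mult(1)[OF I(1) n[of v], of "Poly_Mapping.single (m - Poly_Mapping.single v (n v)) 1"]
          by (simp only: mult.assoc)
      qed
      have "g * f = (\<Sum>m\<in>Poly_Mapping.keys g. scale_mpoly (coef g m) (Poly_Mapping.single m 1)) * f"
        by (simp add: mpoly_expand[symmetric])
      also have "\<dots> = (\<Sum>m\<in>Poly_Mapping.keys g. scale_mpoly (coef g m) (Poly_Mapping.single m 1 * f))"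
        by (simp add: sum_distrib_right scale_mult_left)
      also have "\<dots> \<in> I"
        using g by (intro is_ideal_sum[OF I(1)] is_ideal_scale[OF I(1)] mono) (auto simp: homog_def)
      finally show ?thesis .
    qed
    then show False using I(2) f by (auto simp: saturated_def)
  qed
  then show ?thesis using that by blast
qed

text \<open>Suppose that \<open>l f \<in> I\<close> with \<open>f \<notin> I\<close>. Localizing at a variable \<open>x\<^sub>v\<close> that is not nilpotent on \<open>f\<close>
  gives an ideal \<open>I'\<close> for which \<open>x\<^sub>v\<close> is regular; the Hilbert function of \<open>R/I'\<close> increases and is
  bounded, so \<open>x\<^sub>w/x\<^sub>v\<close> acts on \<open>R/I'\<close> in some degree \<open>e\<close>. The elements killed by a power of \<open>l\<close> form a
  stable subspace that contains a multiple of \<open>f\<close>. A common eigenvector in it gives a zero of \<open>I\<close> at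
  which a power of \<open>l\<close> vanishes.\<close>

lemma regular_if_nonzero_on_zeros:
  fixes I :: "('v::finite, 'k::alg_closed_field) mpoly set"
  assumes hI: "homogeneous_ideal I" and sat: "saturated I"
    and bound: "\<And>i. i \<ge> M \<Longrightarrow> hilbert_fun I i \<le> s"
    and l: "l \<in> homog 1" "\<And>a. a \<in> zeros I \<Longrightarrow> eval_mpoly l a \<noteq> 0"
  shows "regular_on I l"
proof (rule ccontr)
  assume "\<not> regular_on I l"
  then obtain g where g: "l * g \<in> I" "g \<notin> I" using l by (auto simp: regular_on_def)
  note I = homogeneous_idealD(1)[OF hI]
  obtain d where d: "hom_component d g \<notin> I" using homogeneous_ideal_ext[OF hI g(2)] .
  define f where "f = hom_component d g"
  have f: "f \<in> homog d" "f \<notin> I" "l * f \<in> I"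
    using d homog_hom_component homogeneous_idealD(2)[OF hI g(1), of "1 + d"]
    by (auto simp: f_def hom_component_mult[OF l(1), symmetric])
  obtain v where v: "\<And>n. Var v ^ n * f \<notin> I" using saturated_variable[OF I sat f(2)] by metis
  \<comment> \<open>Inverting \<open>x\<^sub>v\<close> keeps \<open>f\<close> nonzero and makes \<open>x\<^sub>v\<close> regular.\<close>
  define I' where "I' = {g. \<exists>n. Var v ^ n * g \<in> I}"
  have up: "Var v ^ (n + k) * g \<in> I" if "Var v ^ n * g \<in> I" for n k g
    using is_ideal_mult(1)[OF I that, of "Var v ^ k"] by (simp add: power_add mult_ac)
  have I': "is_ideal I'"
    unfolding is_ideal_iff
  proof (intro conjI ballI allI)
    show "0 \<in> I'" using is_ideal_0[OF I] by (auto simp: I'_def)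
    show "x + y \<in> I'" if "x \<in> I'" "y \<in> I'" for x y
    proof -
      from that obtain n m where "Var v ^ n * x \<in> I" "Var v ^ m * y \<in> I" by (auto simp: I'_def)
      from is_ideal_add[OF I up[OF this(1), of m] up[OF this(2), of n]]
      have "Var v ^ (n + m) * (x + y) \<in> I" by (simp add: distrib_left add.commute)
      then show ?thesis by (auto simp: I'_def)
    qed
    show "g * x \<in> I'" if "x \<in> I'" for g x
      using that is_ideal_mult(1)[OF I, of _ g] by (auto simp: I'_def mult.left_commute)
  qed
  have II': "I \<subseteq> I'" by (auto simp: I'_def intro: exI[of _ 0])
  have x: "regular_on I' (Var v)"
    unfolding regular_on_def
  proof (intro conjI allI impI)
    fix g assume "Var v * g \<in> I'"
    then obtain n where "Var v ^ n * (Var v * g) \<in> I" by (auto simp: I'_def)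
    then have "Var v ^ Suc n * g \<in> I" by (simp only: power_Suc2 mult.assoc)
    then show "g \<in> I'" unfolding I'_def by blast
  qed simp
  have xf: "Var v ^ n * f \<notin> I'" for n
    using v by (auto simp: I'_def mult.assoc[symmetric] power_add[symmetric])
  have "hilbert_fun I' i \<le> hilbert_fun I i" for i
    unfolding hilbert_fun_def dim_mpoly_def
    by (intro diff_le_mono2 dim_homog_mono[of _ _ i] mp.subspace_inter is_ideal_subspace I I' homog_subspace)
       (use II' in auto)
  then have "hilbert_fun I' i \<le> s" if "i \<ge> max M d" for i
    using bound[of i] that by (metis le_trans max.bounded_iff)
  then obtain e where e: "e \<ge> max M d" "hilbert_fun I' e = hilbert_fun I' (Suc e)"
    using bounded_mono_nat_stalls[where H = "hilbert_fun I'", OF hilbert_fun_regular(1)[OF I' x]] by blast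
  define N where "N = {g \<in> homog e. \<exists>n. l ^ n * g \<in> I'}"
  have lup: "l ^ (n + k) * g \<in> I'" if "l ^ n * g \<in> I'" for n k g
    using is_ideal_mult(1)[OF I' that, of "l ^ k"] by (simp add: power_add mult_ac)
  have subN: "mp.subspace N"
  proof (rule mp.subspaceI)
    show "0 \<in> N" using is_ideal_0[OF I'] by (simp add: N_def)
    show "x + y \<in> N" if "x \<in> N" "y \<in> N" for x y
    proof -
      from that obtain n m where "l ^ n * x \<in> I'" "l ^ m * y \<in> I'" by (auto simp: N_def)
      from is_ideal_add[OF I' lup[OF this(1), of m] lup[OF this(2), of n]]
      have "l ^ (n + m) * (x + y) \<in> I'" by (simp add: distrib_left add.commute)
      then show ?thesis using that by (auto simp: N_def intro: homog_add)
    qed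
    show "scale_mpoly c x \<in> N" if "x \<in> N" for c x
      using that is_ideal_scale[OF I'] by (auto simp: N_def scale_mult_right intro: homog_scale)
  qed
  have "Var v ^ (e - d) * f \<in> N"
  proof -
    have "l * (Var v ^ (e - d) * f) \<in> I"
      using is_ideal_mult(1)[OF I f(3), of "Var v ^ (e - d)"] by (simp add: mult_ac)
    then have "l ^ 1 * (Var v ^ (e - d) * f) \<in> I'" using II' by auto
    moreover have "Var v ^ (e - d) * f \<in> homog e"
      using homog_mult[OF homog_power_1[OF homog_Var(1)] f(1), of v "e - d"] e by simp
    ultimately show ?thesis unfolding N_def by blast
  qed
  then have NI': "\<not> N \<subseteq> I'" using xf by blast
  have stable: "\<exists>h'\<in>N. Var w * h - Var v * h' \<in> I'" if h: "h \<in> N" for h w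
  proof -
    have "Var w * h \<in> homog (Suc e)" using homog_mult[OF homog_Var(1)] h by (fastforce simp: N_def)
    then obtain h' where h': "h' \<in> homog e" "Var w * h - Var v * h' \<in> I'"
      using hilbert_fun_regular(2)[OF I' x e(2)] by blast
    obtain n where "l ^ n * h \<in> I'" using h by (auto simp: N_def)
    then have "Var w * (l ^ n * h) \<in> I'" by (rule is_ideal_mult(1)[OF I'])
    from is_ideal_diff[OF I' this is_ideal_mult(1)[OF I' h'(2), of "l ^ n"]]
    have "Var w * (l ^ n * h) - l ^ n * (Var w * h - Var v * h') \<in> I'" .
    also have "Var w * (l ^ n * h) - l ^ n * (Var w * h - Var v * h') = Var v * (l ^ n * h')"
      by (simp add: algebra_simps)
    finally have "l ^ n * h' \<in> I'" using x unfolding regular_on_def by blast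
    then have "h' \<in> N" using h' unfolding N_def by blast
    then show ?thesis using h' by blast
  qed
  have Ne: "N \<subseteq> homog e" "I' \<inter> homog e \<subseteq> N"
    by (auto simp: N_def intro: exI[of _ 0])
  have xreg: "\<And>g. Var v * g \<in> I' \<Longrightarrow> g \<in> I'" using x unfolding regular_on_def by blast
  obtain a h where h: "h \<in> N" "h \<notin> I'" and ev: "\<And>w. Var w * h - scale_mpoly (a w) (Var v * h) \<in> I'"
    using common_eigenvector_mod_ideal_exists[OF I' xreg subN Ne(1) NI' Ne(2) stable] by metis
  have "a \<in> zeros I" by (rule eigenvalues_zero(2)[OF I' x h(2) ev hI II'])
  moreover obtain n where "l ^ n * h \<in> I'" using h by (auto simp: N_def)
  then have "eval_mpoly l a ^ n = 0"
    using eigenvector_mult_iff[OF I' x h(2) ev homog_power_1[OF l(1)]] by (simp add: eval_power)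
  ultimately show False using l(2) by auto
qed

text \<open>The support is finite, and the linear forms that vanish at one given point are a proper subspace.\<close>

lemma regular_linear_form_exists:
  fixes I :: "('v::finite, 'k::alg_closed_field) mpoly set"
  assumes Z: "zero_dim_subscheme I s"
  obtains l where "regular_on I l"
proof -
  obtain Z0 where Z0: "finite Z0" "Z0 \<subseteq> zeros I" "support I = proj_point ` Z0"
    using Z finite_subset_image[of "support I" proj_point "zeros I"]
    by (auto simp: zero_dim_subscheme_def support_def)
  have ex: "\<exists>l\<in>homog 1. eval_mpoly l a \<noteq> 0" if "a \<in> Z0" for a
  proof -
    from that Z0 have "a \<noteq> (\<lambda>_. 0)" by (auto simp: zeros_def)
    then obtain v where "a v \<noteq> 0" by auto
    then show ?thesis by (intro bexI[of _ "Var v"]) auto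
  qed
  obtain l where l: "l \<in> homog 1" "\<And>a. a \<in> Z0 \<Longrightarrow> eval_mpoly l a \<noteq> 0"
    using avoid_hyperplanes[of "homog 1" "\<lambda>a l. eval_mpoly l a" Z0, OF infinite_UNIV_alg_closed homog_subspace _ Z0(1) ex]
    by (auto simp: eval_add)
  have nz: "eval_mpoly l a \<noteq> 0" if a: "a \<in> zeros I" for a
  proof -
    have "proj_point a \<in> proj_point ` Z0" using a Z0 by (auto simp: support_def)
    then obtain b where b: "b \<in> Z0" "proj_point a = proj_point b" by auto
    moreover have "a \<in> proj_point a" unfolding proj_point_def by (auto intro: exI[of _ 1])
    ultimately obtain c where "c \<noteq> 0" "a = (\<lambda>v. c * b v)" by (auto simp: proj_point_def)
    then show ?thesis using l(2)[OF b(1)] eval_homog_scaled[OF l(1), of c b] by simp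
  qed
  obtain M where M: "\<And>i. i \<ge> M \<Longrightarrow> hilbert_fun I i = s"
    using Z by (auto simp: zero_dim_subscheme_def eventually_sequentially)
  have "regular_on I l"
  proof (rule regular_if_nonzero_on_zeros[of I M s l, OF _ _ _ l(1) nz])
    show "homogeneous_ideal I" "saturated I" using Z by (auto simp: zero_dim_subscheme_def)
    show "hilbert_fun I i \<le> s" if "i \<ge> M" for i using M[OF that] by simp
  qed
  then show ?thesis by (rule that)
qed

section \<open>The Hilbert function beyond \<open>\<tau>\<close> and generators\<close>

context
  fixes I :: "('v::finite, 'k::field) mpoly set" and s :: nat and l
  assumes Z: "zero_dim_subscheme I s" and l: "regular_on I l"
begin

lemma zero_dim_ideal: "is_ideal I" "homogeneous_ideal I" "saturated I"
  using Z by (auto simp: zero_dim_subscheme_def homogeneous_ideal_def)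

text \<open>\<open>\<tau>\<close> is only the first degree in which the value \<open>s\<close> occurs; monotonicity makes it permanent.\<close>

lemma hilbert_fun_eq_degree:
  assumes "tau I s \<le> i"
  shows "hilbert_fun I i = s"
proof -
  have mono: "hilbert_fun I m \<le> hilbert_fun I n" if "m \<le> n" for m n
    using lift_Suc_mono_le[of "hilbert_fun I", OF hilbert_fun_regular(1)[OF zero_dim_ideal(1) l] that] .
  obtain M where M: "\<And>i. i \<ge> M \<Longrightarrow> hilbert_fun I i = s"
    using Z by (auto simp: zero_dim_subscheme_def eventually_sequentially)
  have "hilbert_fun I (tau I s) = s" unfolding tau_def by (rule LeastI[of _ M]) (simp add: M)
  then show ?thesis
    using mono[OF assms] mono[of i "max M i"] M[of "max M i"] by simp
qed

lemma regular_form_surjective: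
  assumes "tau I s \<le> i" "f \<in> homog (Suc i)"
  shows "\<exists>g\<in>homog i. f - l * g \<in> I"
  using hilbert_fun_regular(2)[OF zero_dim_ideal(1) l _ assms(2)]
    hilbert_fun_eq_degree[OF assms(1)] hilbert_fun_eq_degree[of "Suc i"] assms(1) by simp

text \<open>\<open>R/I\<close> has Castelnuovo--Mumford regularity \<open>\<tau>\<close>, so \<open>I\<close> has no generators above degree \<open>\<tau> + 1\<close>.
  The direct argument: above degree \<open>\<tau>\<close> every form is congruent modulo \<open>I\<close> to a multiple of \<open>l\<close>.
  Substituting this in an expression of \<open>f \<in> I\<^sub>e\<^sub>+\<^sub>1\<close> by variables gives \<open>f \<equiv> l h\<close> modulo
  \<open>R\<^sub>1 I\<^sub>e\<close>, and regularity of \<open>l\<close> forces \<open>h \<in> I\<^sub>e\<close>.\<close>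

lemma ideal_generated_above_tau:
  assumes J: "is_ideal J" "J \<subseteq> I" and d: "tau I s < d" "I \<inter> homog d \<subseteq> J"
  shows "d \<le> e \<Longrightarrow> I \<inter> homog e \<subseteq> J"
proof (induct e rule: dec_induct)
  case base
  then show ?case using d by blast
next
  case (step e)
  show ?case
  proof
    fix f assume f: "f \<in> I \<inter> homog (Suc e)"
    let ?S = "{f. \<exists>h\<in>homog e. f - l * h \<in> J}"
    have S: "mp.subspace ?S"
    proof (rule mp.subspaceI)
      show "0 \<in> ?S" using is_ideal_0[OF J(1)] by (auto intro!: bexI[of _ 0])
      fix x assume "x \<in> ?S"
      then obtain h where h: "h \<in> homog e" "x - l * h \<in> J" by blast
      have "scale_mpoly c x - l * scale_mpoly c h \<in> J" for c
        using is_ideal_scale[OF J(1) h(2), of c] by (simp add: mp.scale_right_diff_distrib scale_mult_right)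
      then show "scale_mpoly c x \<in> ?S" for c using h homog_scale by blast
      fix y assume "y \<in> ?S"
      then obtain k where k: "k \<in> homog e" "y - l * k \<in> J" by blast
      have "x + y - l * (h + k) \<in> J"
        using is_ideal_add[OF J(1) h(2) k(2)] by (simp add: algebra_simps)
      then show "x + y \<in> ?S" using h k homog_add by blast
    qed
    have "f \<in> ?S"
    proof (rule homog_Suc_induct[OF _ S])
      show "f \<in> homog (Suc e)" using f by blast
      fix v :: 'v and g :: "('v, 'k) mpoly" assume g: "g \<in> homog e"
      obtain e' where e': "e = Suc e'" "tau I s \<le> e'"
        using step d by (cases e) auto
      obtain g' where g': "g' \<in> homog e'" "g - l * g' \<in> I"
        using regular_form_surjective[OF e'(2)] g e' by blast
      have "l * g' \<in> homog e"
        using homog_mult[OF _ g'(1), of l 1] l e' by (simp add: regular_on_def)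
      then have "g - l * g' \<in> J" using step g' g homog_diff by blast
      then have "Var v * (g - l * g') \<in> J" by (rule is_ideal_mult(1)[OF J(1)])
      then have "Var v * g - l * (Var v * g') \<in> J" by (simp add: algebra_simps)
      moreover have "Var v * g' \<in> homog e" using homog_mult[OF homog_Var(1) g'(1)] e' by simp
      ultimately show "Var v * g \<in> ?S" by blast
    qed
    then obtain h where h: "h \<in> homog e" "f - l * h \<in> J" by blast
    have "f - (f - l * h) \<in> I"
      by (rule is_ideal_diff[OF zero_dim_ideal(1)]) (use f h J in auto)
    then have "h \<in> I" using l by (simp add: regular_on_def)
    then have "l * h \<in> J" using h step is_ideal_mult(1)[OF J(1)] by blast
    with is_ideal_add[OF J(1) h(2) this] show "f \<in> J" by simp
  qed
qed

end

section \<open>Socles of the local rings\<close>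

text \<open>The local ring at \<open>a\<close> consists of classes of fractions. Its ring structure and its maximal ideal,
  which is the set of fractions that vanish at \<open>a\<close>, have to be known before the Gorenstein condition
  can be applied to an element \<open>h/l\<^sup>e\<close>.\<close>

context
  fixes I :: "('v::finite, 'k::field) mpoly set" and a :: "'v \<Rightarrow> 'k"
  assumes I: "is_ideal I" and a: "a \<in> zeros I"
begin

private abbreviation "isfrac f g \<equiv> (f, g) \<in> fractions a"
private abbreviation "cl f g \<equiv> frac_rel I a `` {(f, g)}"
private abbreviation "A \<equiv> local_ring I a"

lemma frac_I: "f \<in> homog d \<Longrightarrow> g \<in> homog d \<Longrightarrow> eval_mpoly g a \<noteq> 0 \<Longrightarrow> isfrac f g"
  by (auto simp: fractions_def)

lemma frac_E:
  assumes "isfrac f g"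
  obtains d where "f \<in> homog d" "g \<in> homog d" "eval_mpoly g a \<noteq> 0"
  using assms by (auto simp: fractions_def)

lemma frac_0_1 [simp]: "isfrac 0 1" "isfrac 1 1"
  by (rule frac_I[of _ 0]; simp)+

lemma frac_mult: "isfrac f g \<Longrightarrow> isfrac f' g' \<Longrightarrow> isfrac (f * f') (g * g')"
  by (elim frac_E, rule frac_I) (auto intro: homog_mult simp: eval_mult)

lemma frac_add: "isfrac f g \<Longrightarrow> isfrac f' g' \<Longrightarrow> isfrac (f * g' + f' * g) (g * g')"
  by (elim frac_E, rule frac_I)
     (auto intro!: homog_add intro: homog_mult simp: eval_mult, metis add.commute homog_mult)

lemma frac_uminus: "isfrac f g \<Longrightarrow> isfrac (- f) g"
  using homog_diff[OF homog_0] by (elim frac_E, intro frac_I) auto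

lemma frac_zero: "isfrac f g \<Longrightarrow> isfrac 0 g"
  by (elim frac_E, intro frac_I) auto

lemma frac_rel_iff:
  "((f, g), (f', g')) \<in> frac_rel I a \<longleftrightarrow> isfrac f g \<and> isfrac f' g' \<and>
     (\<exists>d. \<exists>u\<in>homog d. eval_mpoly u a \<noteq> 0 \<and> u * (f * g' - f' * g) \<in> I)"
  by (simp add: frac_rel_def)

lemma frac_rel_equiv: "equiv (fractions a) (frac_rel I a)"
proof (rule equivI)
  show "frac_rel I a \<subseteq> fractions a \<times> fractions a" by (auto simp: frac_rel_def)
  show "refl_on (fractions a) (frac_rel I a)"
    by (rule refl_onI) (auto simp: frac_rel_def intro!: exI[of _ 0] bexI[of _ 1] is_ideal_0[OF I])
  show "sym (frac_rel I a)"
  proof (rule symI; clarsimp simp: frac_rel_iff)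
    fix f g f' g' d u
    assume *: "u \<in> homog d" "eval_mpoly u a \<noteq> 0" "u * (f * g' - f' * g) \<in> I"
    have "u * (f' * g - f * g') = 0 - u * (f * g' - f' * g)" by (simp add: algebra_simps)
    also have "\<dots> \<in> I" by (intro is_ideal_diff[OF I] is_ideal_0[OF I] *)
    finally show "\<exists>d. \<exists>u\<in>homog d. eval_mpoly u a \<noteq> 0 \<and> u * (f' * g - f * g') \<in> I"
      using * by blast
  qed
  show "trans (frac_rel I a)"
  proof (rule transI; clarsimp simp: frac_rel_iff)
    fix f g f' g' f'' g'' d u d' u'
    assume g': "isfrac f' g'" and u: "u \<in> homog d" "eval_mpoly u a \<noteq> 0" "u * (f * g' - f' * g) \<in> I"
      and u': "u' \<in> homog d'" "eval_mpoly u' a \<noteq> 0" "u' * (f' * g'' - f'' * g') \<in> I"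
    obtain k where k: "g' \<in> homog k" "eval_mpoly g' a \<noteq> 0" using g' by (rule frac_E)
    have "(u * u' * g') * (f * g'' - f'' * g)
        = (u' * g'') * (u * (f * g' - f' * g)) + (u * g) * (u' * (f' * g'' - f'' * g'))"
      by (simp add: algebra_simps)
    also have "\<dots> \<in> I" by (intro is_ideal_add[OF I] is_ideal_mult(1)[OF I] u u')
    finally show "\<exists>d. \<exists>u\<in>homog d. eval_mpoly u a \<noteq> 0 \<and> u * (f * g'' - f'' * g) \<in> I"
      using u u' k by (intro exI[of _ "d + d' + k"] bexI[of _ "u * u' * g'"] conjI homog_mult)
        (auto simp: eval_mult)
  qed
qed

lemma cl_eq_iff:
  assumes "isfrac f g" "isfrac f' g'"
  shows "cl f g = cl f' g' \<longleftrightarrow> (\<exists>d. \<exists>u\<in>homog d. eval_mpoly u a \<noteq> 0 \<and> u * (f * g' - f' * g) \<in> I)"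
  using eq_equiv_class_iff[OF frac_rel_equiv assms] assms by (simp add: frac_rel_iff)

lemma cl_eqI:
  assumes "isfrac f g" "isfrac f' g'" "f * g' - f' * g \<in> I"
  shows "cl f g = cl f' g'"
  unfolding cl_eq_iff[OF assms(1,2)] using assms(3) by (intro exI[of _ 0] bexI[of _ 1]) auto

lemma cl_eqI':
  assumes "isfrac f g" "isfrac f' g'" "f * g' = f' * g"
  shows "cl f g = cl f' g'"
  using assms is_ideal_0[OF I] by (intro cl_eqI) auto

lemma cl_mem: "isfrac f g \<Longrightarrow> cl f g \<in> carrier A"
  by (auto simp: local_ring_def quotient_def)

lemma carrier_E:
  assumes "X \<in> carrier A"
  obtains f g where "isfrac f g" "X = cl f g"
  using assms by (auto simp: local_ring_def quotient_def)

text \<open>The operations of the local ring are unions over all representatives of two classes; a union of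
  equal sets is any one of them.\<close>

lemma union_over_classes:
  assumes p: "isfrac f g" and q: "isfrac f' g'"
    and c: "\<And>f1 g1 f1' g1'. ((f, g), (f1, g1)) \<in> frac_rel I a \<Longrightarrow>
      ((f', g'), (f1', g1')) \<in> frac_rel I a \<Longrightarrow> G f1 g1 f1' g1' = C"
  shows "(\<Union>(f, g)\<in>cl f g. \<Union>(f', g')\<in>cl f' g'. G f g f' g') = C"
proof -
  have "(f, g) \<in> cl f g" "(f', g') \<in> cl f' g'"
    using equiv_class_self[OF frac_rel_equiv] p q by auto
  then show ?thesis using c by fastforce
qed

lemma cl_mult:
  assumes "isfrac f g" "isfrac f' g'"
  shows "cl f g \<otimes>\<^bsub>A\<^esub> cl f' g' = cl (f * f') (g * g')"
  unfolding local_ring_def monoid.simps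
proof (rule union_over_classes[OF assms])
  fix f1 g1 f1' g1'
  assume "((f, g), (f1, g1)) \<in> frac_rel I a" "((f', g'), (f1', g1')) \<in> frac_rel I a"
  then obtain d u d' u' where fr: "isfrac f1 g1" "isfrac f1' g1'"
    and u: "u \<in> homog d" "eval_mpoly u a \<noteq> 0" "u * (f * g1 - f1 * g) \<in> I"
    and u': "u' \<in> homog d'" "eval_mpoly u' a \<noteq> 0" "u' * (f' * g1' - f1' * g') \<in> I"
    by (auto simp: frac_rel_iff)
  have "(u * u') * ((f * f') * (g1 * g1') - (f1 * f1') * (g * g'))
      = (u' * f' * g1') * (u * (f * g1 - f1 * g)) + (u * f1 * g) * (u' * (f' * g1' - f1' * g'))"
    by (simp add: algebra_simps)
  also have "\<dots> \<in> I" by (intro is_ideal_add[OF I] is_ideal_mult(1)[OF I] u u')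
  finally have "cl (f * f') (g * g') = cl (f1 * f1') (g1 * g1')"
    unfolding cl_eq_iff[OF frac_mult[OF assms] frac_mult[OF fr]]
    using u u' by (intro exI[of _ "d + d'"] bexI[of _ "u * u'"] conjI homog_mult) (auto simp: eval_mult)
  then show "cl (f1 * f1') (g1 * g1') = cl (f * f') (g * g')" by simp
qed

lemma cl_add:
  assumes "isfrac f g" "isfrac f' g'"
  shows "cl f g \<oplus>\<^bsub>A\<^esub> cl f' g' = cl (f * g' + f' * g) (g * g')"
  unfolding local_ring_def ring.simps
proof (rule union_over_classes[OF assms])
  fix f1 g1 f1' g1'
  assume "((f, g), (f1, g1)) \<in> frac_rel I a" "((f', g'), (f1', g1')) \<in> frac_rel I a"
  then obtain d u d' u' where fr: "isfrac f1 g1" "isfrac f1' g1'"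
    and u: "u \<in> homog d" "eval_mpoly u a \<noteq> 0" "u * (f * g1 - f1 * g) \<in> I"
    and u': "u' \<in> homog d'" "eval_mpoly u' a \<noteq> 0" "u' * (f' * g1' - f1' * g') \<in> I"
    by (auto simp: frac_rel_iff)
  have "(u * u') * ((f * g' + f' * g) * (g1 * g1') - (f1 * g1' + f1' * g1) * (g * g'))
      = (u' * g' * g1') * (u * (f * g1 - f1 * g)) + (u * g * g1) * (u' * (f' * g1' - f1' * g'))"
    by (simp add: algebra_simps)
  also have "\<dots> \<in> I" by (intro is_ideal_add[OF I] is_ideal_mult(1)[OF I] u u')
  finally have "cl (f * g' + f' * g) (g * g') = cl (f1 * g1' + f1' * g1) (g1 * g1')"
    unfolding cl_eq_iff[OF frac_add[OF assms] frac_add[OF fr]]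
    using u u' by (intro exI[of _ "d + d'"] bexI[of _ "u * u'"] conjI homog_mult) (auto simp: eval_mult)
  then show "cl (f1 * g1' + f1' * g1) (g1 * g1') = cl (f * g' + f' * g) (g * g')" by simp
qed

lemma local_ring_one: "\<one>\<^bsub>A\<^esub> = cl 1 1" and local_ring_zero: "\<zero>\<^bsub>A\<^esub> = cl 0 1"
  by (simp_all add: local_ring_def)

lemma local_ring_cring: "cring A"
proof (rule cringI)
  note simps = cl_mult cl_add frac_mult frac_add local_ring_one local_ring_zero
  show "abelian_group A"
  proof (rule abelian_groupI)
    fix X Y W assume "X \<in> carrier A" "Y \<in> carrier A" "W \<in> carrier A"
    then obtain f g f' g' f'' g'' where [simp]: "isfrac f g" "isfrac f' g'" "isfrac f'' g''"
      and X: "X = cl f g" "Y = cl f' g'" "W = cl f'' g''"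
      by (elim carrier_E) blast
    show "X \<oplus>\<^bsub>A\<^esub> Y \<in> carrier A" unfolding X by (simp add: simps cl_mem)
    show "(X \<oplus>\<^bsub>A\<^esub> Y) \<oplus>\<^bsub>A\<^esub> W = X \<oplus>\<^bsub>A\<^esub> (Y \<oplus>\<^bsub>A\<^esub> W)"
      unfolding X by (simp add: simps) (intro cl_eqI' frac_add frac_mult, simp_all add: algebra_simps)
    show "X \<oplus>\<^bsub>A\<^esub> Y = Y \<oplus>\<^bsub>A\<^esub> X"
      unfolding X by (simp add: simps) (intro cl_eqI' frac_add frac_mult, simp_all add: algebra_simps)
    show "\<zero>\<^bsub>A\<^esub> \<oplus>\<^bsub>A\<^esub> X = X"
      unfolding X by (simp add: simps)
    show "\<exists>y\<in>carrier A. y \<oplus>\<^bsub>A\<^esub> X = \<zero>\<^bsub>A\<^esub>"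
    proof (rule bexI)
      show "cl (- f) g \<oplus>\<^bsub>A\<^esub> X = \<zero>\<^bsub>A\<^esub>"
        unfolding X by (simp add: simps frac_uminus) (rule cl_eqI', auto intro: frac_zero[OF frac_mult[of f g f g]])
    qed (simp add: cl_mem frac_uminus)
  next
    show "\<zero>\<^bsub>A\<^esub> \<in> carrier A" by (simp add: local_ring_zero cl_mem)
  qed
  show "Group.comm_monoid A"
  proof (rule comm_monoidI)
    fix X Y W assume "X \<in> carrier A" "Y \<in> carrier A" "W \<in> carrier A"
    then obtain f g f' g' f'' g'' where [simp]: "isfrac f g" "isfrac f' g'" "isfrac f'' g''"
      and X: "X = cl f g" "Y = cl f' g'" "W = cl f'' g''"
      by (elim carrier_E) blast
    show "X \<otimes>\<^bsub>A\<^esub> Y \<in> carrier A" unfolding X by (simp add: simps cl_mem)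
    show "(X \<otimes>\<^bsub>A\<^esub> Y) \<otimes>\<^bsub>A\<^esub> W = X \<otimes>\<^bsub>A\<^esub> (Y \<otimes>\<^bsub>A\<^esub> W)"
      unfolding X by (simp add: simps mult.assoc)
    show "X \<otimes>\<^bsub>A\<^esub> Y = Y \<otimes>\<^bsub>A\<^esub> X"
      unfolding X by (simp add: simps mult.commute)
    show "\<one>\<^bsub>A\<^esub> \<otimes>\<^bsub>A\<^esub> X = X"
      unfolding X by (simp add: simps)
  next
    show "\<one>\<^bsub>A\<^esub> \<in> carrier A" by (simp add: local_ring_one cl_mem)
  qed
  fix X Y W assume "X \<in> carrier A" "Y \<in> carrier A" "W \<in> carrier A"
  then obtain f g f' g' f'' g'' where [simp]: "isfrac f g" "isfrac f' g'" "isfrac f'' g''"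
    and X: "X = cl f g" "Y = cl f' g'" "W = cl f'' g''"
    by (elim carrier_E) blast
  show "(X \<oplus>\<^bsub>A\<^esub> Y) \<otimes>\<^bsub>A\<^esub> W = X \<otimes>\<^bsub>A\<^esub> W \<oplus>\<^bsub>A\<^esub> Y \<otimes>\<^bsub>A\<^esub> W"
    unfolding X by (simp add: simps) (intro cl_eqI' frac_add frac_mult, simp_all add: algebra_simps)
qed

definition vanishing_fractions where
  "vanishing_fractions = {cl f g | f g. isfrac f g \<and> eval_mpoly f a = 0}"

text \<open>Vanishing at \<open>a\<close> does not depend on the representative, because all elements of \<open>I\<close> vanish at \<open>a\<close>.\<close>

lemma cl_vanishing_iff:
  assumes "isfrac f g"
  shows "cl f g \<in> vanishing_fractions \<longleftrightarrow> eval_mpoly f a = 0"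
proof
  assume "cl f g \<in> vanishing_fractions"
  then obtain f' g' where f': "isfrac f' g'" "eval_mpoly f' a = 0" "cl f g = cl f' g'"
    by (auto simp: vanishing_fractions_def)
  then obtain u where u: "eval_mpoly u a \<noteq> 0" "u * (f * g' - f' * g) \<in> I"
    using cl_eq_iff[OF assms f'(1)] by auto
  have "eval_mpoly (u * (f * g' - f' * g)) a = 0" using a u by (auto simp: zeros_def)
  moreover have "eval_mpoly g' a \<noteq> 0" using f'(1) by (auto elim: frac_E)
  ultimately show "eval_mpoly f a = 0" using u f' by (simp add: eval_mult eval_diff)
qed (use assms in \<open>auto simp: vanishing_fractions_def\<close>)

text \<open>A fraction that does not vanish at \<open>a\<close> has an inverse, so every ideal that is not contained in the
  set of vanishing fractions is the whole ring.\<close>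

lemma max_ideal_local_ring: "max_ideal A = vanishing_fractions"
proof -
  interpret A: cring A by (rule local_ring_cring)
  let ?M = vanishing_fractions
  have ME: "\<exists>f g. X = cl f g \<and> isfrac f g \<and> eval_mpoly f a = 0" if "X \<in> ?M" for X
    using that by (auto simp: vanishing_fractions_def)
  have sub: "?M \<subseteq> carrier A" by (auto dest!: ME intro: cl_mem)
  have mult: "X \<otimes>\<^bsub>A\<^esub> Y \<in> ?M" if Y: "Y \<in> ?M" and X: "X \<in> carrier A" for X Y
  proof -
    obtain f g where Y: "Y = cl f g" "isfrac f g" "eval_mpoly f a = 0" using ME[OF Y] by blast
    obtain f' g' where X: "X = cl f' g'" "isfrac f' g'" using X by (elim carrier_E) blast
    show ?thesis using X Y by (simp add: cl_mult cl_vanishing_iff frac_mult eval_mult)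
  qed
  have M: "ideal ?M A"
  proof (rule idealI)
    show "ring A" by (rule A.ring_axioms)
    show "subgroup ?M (add_monoid A)"
    proof (rule A.add.subgroupI)
      show "?M \<subseteq> carrier A" by (rule sub)
      show "?M \<noteq> {}" using cl_vanishing_iff[OF frac_0_1(1)] by auto
      show "\<ominus>\<^bsub>A\<^esub> X \<in> ?M" if X: "X \<in> ?M" for X
      proof -
        have "\<ominus>\<^bsub>A\<^esub> X = \<ominus>\<^bsub>A\<^esub> \<one>\<^bsub>A\<^esub> \<otimes>\<^bsub>A\<^esub> X" using X sub by (auto simp: A.l_minus)
        then show ?thesis using mult[OF X] by simp
      qed
      show "X \<oplus>\<^bsub>A\<^esub> Y \<in> ?M" if "X \<in> ?M" "Y \<in> ?M" for X Y
        using ME[OF that(1)] ME[OF that(2)]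
        by (auto simp: cl_add cl_vanishing_iff frac_add eval_add eval_mult)
    qed
    show "X \<otimes>\<^bsub>A\<^esub> Y \<in> ?M" "Y \<otimes>\<^bsub>A\<^esub> X \<in> ?M" if "Y \<in> ?M" "X \<in> carrier A" for X Y
      using mult[OF that] that sub A.m_comm[of Y X] by auto
  qed
  have one: "\<one>\<^bsub>A\<^esub> \<notin> ?M" by (simp add: local_ring_one cl_vanishing_iff)
  have big: "J = carrier A" if J: "ideal J A" "\<not> J \<subseteq> ?M" for J
  proof -
    interpret J: ideal J A by fact
    obtain X where X: "X \<in> J" "X \<notin> ?M" using J by blast
    have "X \<in> carrier A" using X(1) by (rule J.Icarr)
    then obtain f g where fg: "isfrac f g" "X = cl f g" by (elim carrier_E) blast
    then have gf: "isfrac g f" using X by (auto simp: cl_vanishing_iff elim!: frac_E intro: frac_I)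
    have "cl g f \<otimes>\<^bsub>A\<^esub> X \<in> J" by (rule J.I_l_closed[OF X(1) cl_mem[OF gf]])
    also have "cl g f \<otimes>\<^bsub>A\<^esub> X = \<one>\<^bsub>A\<^esub>"
      unfolding fg(2) cl_mult[OF gf fg(1)] local_ring_one
      by (rule cl_eqI') (auto simp: frac_mult gf fg)
    finally show ?thesis by (rule J.one_imp_carrier)
  qed
  have "maximalideal ?M A"
    by (rule maximalidealI[OF M]) (use one big sub in auto)
  moreover have "J = ?M" if "maximalideal J A" for J
  proof -
    interpret J: maximalideal J A by fact
    have "J \<subseteq> ?M" using big[OF J.is_ideal] J.I_notcarr by blast
    then show ?thesis using J.I_maximal[OF M _ sub] one A.one_closed by auto
  qed
  ultimately show ?thesis unfolding max_ideal_def by (rule the_equality)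
qed

text \<open>A form that vanishes at \<open>a\<close> annihilates a common eigenvector with eigenvalues \<open>a\<close>, so \<open>h/l\<^sup>e\<close> and
  \<open>h'/l\<^sup>e\<close> lie in the socle of the local ring at \<open>a\<close>, which is a line. Passing to this local ring loses
  nothing: a form that does not vanish at \<open>a\<close> cannot annihilate a common eigenvector outside \<open>I\<close>.\<close>

lemma gorenstein_eigenvector_unique:
  assumes l: "regular_on I l" "eval_mpoly l a = 1"
    and gor: "gorenstein_artinian A"
    and h: "h \<in> homog e" "h \<notin> I" and h': "h' \<in> homog e"
    and ev: "\<And>w. Var w * h - scale_mpoly (a w) (l * h) \<in> I"
    and ev': "\<And>w. Var w * h' - scale_mpoly (a w) (l * h') \<in> I"
  shows "\<exists>c. h' - scale_mpoly c h \<in> I"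
proof -
  interpret A: cring A by (rule local_ring_cring)
  have le: "l ^ e \<in> homog e" "eval_mpoly (l ^ e) a \<noteq> 0"
    using l homog_power_1[of l e] by (auto simp: regular_on_def eval_power)
  have fr: "isfrac p (l ^ e)" if "p \<in> homog e" for p using frac_I[OF that le] .
  have soc: "cl p (l ^ e) \<in> socle A"
    if p: "p \<in> homog e" and evp: "\<And>w. Var w * p - scale_mpoly (a w) (l * p) \<in> I" for p
    unfolding socle_def max_ideal_local_ring
  proof (clarsimp simp: cl_mem fr p vanishing_fractions_def)
    fix f g assume f: "isfrac f g" "eval_mpoly f a = 0"
    obtain d where d: "f \<in> homog d" using f by (auto elim: frac_E)
    have "f * p \<in> I"
      using is_ideal_cong[OF I eigenvector_eval[OF I evp d]] f is_ideal_0[OF I] by simp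
    then show "cl f g \<otimes>\<^bsub>A\<^esub> cl p (l ^ e) = \<zero>\<^bsub>A\<^esub>"
      unfolding cl_mult[OF f(1) fr[OF p]] local_ring_zero
      by (intro cl_eqI) (auto simp: frac_mult f fr p)
  qed
  obtain x where x: "x \<in> socle A" "socle A = PIdl\<^bsub>A\<^esub> x"
    using gor by (auto simp: gorenstein_artinian_def)
  then obtain p q where pq: "isfrac p q" "x = cl p q" by (auto simp: socle_def elim: carrier_E)
  \<comment> \<open>The maximal ideal kills the socle, so ring multiples of \<open>x\<close> are scalar multiples.\<close>
  have mult: "\<exists>c. r \<otimes>\<^bsub>A\<^esub> x = cl (scale_mpoly c p) q" if r: "r \<in> carrier A" for r
  proof -
    obtain f g where fg: "isfrac f g" "r = cl f g" using r by (elim carrier_E) blast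
    obtain d where d: "f \<in> homog d" "g \<in> homog d" "eval_mpoly g a \<noteq> 0" using fg(1) by (rule frac_E)
    define c where "c = eval_mpoly f a / eval_mpoly g a"
    have fr': "isfrac (f - scale_mpoly c g) g" using d by (auto intro!: frac_I homog_diff homog_scale)
    have "cl (f - scale_mpoly c g) g \<in> max_ideal A"
      unfolding max_ideal_local_ring cl_vanishing_iff[OF fr'] using d by (simp add: c_def eval_diff)
    then have "cl (f - scale_mpoly c g) g \<otimes>\<^bsub>A\<^esub> x = \<zero>\<^bsub>A\<^esub>" using x(1) by (auto simp: socle_def)
    then have "cl ((f - scale_mpoly c g) * p) (g * q) = cl 0 1"
      unfolding pq(2) local_ring_zero cl_mult[OF fr' pq(1)] .
    then obtain k u where u: "u \<in> homog k" "eval_mpoly u a \<noteq> 0" "u * ((f - scale_mpoly c g) * p) \<in> I"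
      using cl_eq_iff[OF frac_mult[OF fr' pq(1)] frac_0_1(1)] by auto
    have frp: "isfrac (scale_mpoly c p) q" using pq(1) by (auto elim!: frac_E intro: frac_I homog_scale)
    have "r \<otimes>\<^bsub>A\<^esub> x = cl (f * p) (g * q)" unfolding fg(2) pq(2) by (rule cl_mult[OF fg(1) pq(1)])
    also have "\<dots> = cl (scale_mpoly c p) q"
      unfolding cl_eq_iff[OF frac_mult[OF fg(1) pq(1)] frp]
    proof (intro exI[of _ k] bexI[of _ u] conjI)
      have "u * (f * p * q - scale_mpoly c p * (g * q)) = q * (u * ((f - scale_mpoly c g) * p))"
        by (simp add: scale_mpoly_def algebra_simps)
      also have "\<dots> \<in> I" by (rule is_ideal_mult(1)[OF I u(3)])
      finally show "u * (f * p * q - scale_mpoly c p * (g * q)) \<in> I" .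
    qed (use u in auto)
    finally show ?thesis ..
  qed
  have rep: "\<exists>c. cl y (l ^ e) = cl (scale_mpoly c p) q"
    if "y \<in> homog e" "\<And>w. Var w * y - scale_mpoly (a w) (l * y) \<in> I" for y
    using soc[OF that] mult unfolding x(2) cgenideal_def by auto
  obtain c where c: "cl h (l ^ e) = cl (scale_mpoly c p) q" using rep[OF h(1) ev] by blast
  obtain c' where c': "cl h' (l ^ e) = cl (scale_mpoly c' p) q" using rep[OF h' ev'] by blast
  have frp: "isfrac (scale_mpoly c p) q" for c using pq(1) by (auto elim!: frac_E intro: frac_I homog_scale)
  have "cl h (l ^ e) \<noteq> cl 0 1"
  proof
    assume "cl h (l ^ e) = cl 0 1"
    then obtain k u where u: "u \<in> homog k" "eval_mpoly u a \<noteq> 0" "u * h \<in> I"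
      using cl_eq_iff[OF fr[OF h(1)] frac_0_1(1)] by auto
    then show False using eigenvector_mult_iff[OF I l(1) h(2) ev u(1)] by simp
  qed
  then have c0: "c \<noteq> 0" using c cl_eqI'[OF frp[of 0] frac_0_1(1)] by auto
  define H where "H = h' - scale_mpoly (c' / c) h"
  have evH: "Var w * H - scale_mpoly (a w) (l * H) \<in> I" for w
  proof -
    have "Var w * H - scale_mpoly (a w) (l * H) = (Var w * h' - scale_mpoly (a w) (l * h'))
        - scale_mpoly (c' / c) (Var w * h - scale_mpoly (a w) (l * h))"
      by (simp add: H_def scale_mpoly_def algebra_simps)
    also have "\<dots> \<in> I" by (intro is_ideal_diff[OF I] is_ideal_scale[OF I] ev ev')
    finally show ?thesis .
  qed
  obtain k u where u: "u \<in> homog k" "eval_mpoly u a \<noteq> 0" "u * (h * q - scale_mpoly c p * l ^ e) \<in> I"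
    using cl_eq_iff[OF fr[OF h(1)] frp[of c]] c by auto
  obtain k' u' where u': "u' \<in> homog k'" "eval_mpoly u' a \<noteq> 0" "u' * (h' * q - scale_mpoly c' p * l ^ e) \<in> I"
    using cl_eq_iff[OF fr[OF h'] frp[of c']] c' by auto
  obtain m where q: "q \<in> homog m" "eval_mpoly q a \<noteq> 0" using pq(1) by (rule frac_E)
  have cc: "scale_mpoly c' p = scale_mpoly (c' / c) (scale_mpoly c p)" using c0 by simp
  have "(u * u' * q) * H = u * (u' * (h' * q - scale_mpoly c' p * l ^ e))
      - scale_mpoly (c' / c) (u' * (u * (h * q - scale_mpoly c p * l ^ e)))"
    unfolding cc H_def by (simp add: scale_mpoly_def algebra_simps)
  also have "\<dots> \<in> I" by (intro is_ideal_diff[OF I] is_ideal_scale[OF I] is_ideal_mult(1)[OF I] u u')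
  finally have uH: "(u * u' * q) * H \<in> I" .
  have "H \<in> I"
  proof (rule ccontr)
    assume "H \<notin> I"
    from eigenvector_mult_iff[OF I l(1) this evH homog_mult[OF homog_mult[OF u(1) u'(1)] q(1)]] uH
    show False using u u' q by (simp add: eval_mult)
  qed
  then show ?thesis by (auto simp: H_def)
qed

end

section \<open>Nondegenerate elements of the inverse system\<close>

text \<open>The right radical of the form \<open>(g, h) \<mapsto> F(g h)\<close> on \<open>R\<^sub>t \<times> R\<^sub>j\<^sub>-\<^sub>t\<close> always contains \<open>I\<^sub>j\<^sub>-\<^sub>t\<close> if \<open>F\<close> is in
  the inverse system; it is required to be no larger.\<close>

definition nondegenerate ::
    "('v::finite, 'k::field) mpoly set \<Rightarrow> nat \<Rightarrow> nat \<Rightarrow> ('v, 'k) dpoly \<Rightarrow> bool" where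
  "nondegenerate I t j F \<longleftrightarrow> F \<in> inverse_system I j \<and>
     (\<forall>h\<in>homog (j - t). (\<forall>g\<in>homog t. ip (g * h) F = 0) \<longrightarrow> h \<in> I)"

lemma inverse_system_ip:
  assumes "is_ideal I" "F \<in> inverse_system I j" "h \<in> I" "h \<in> homog j"
  shows "ip h F = 0"
  using assms by (simp add: inverse_system_eq_perp perp_def)

text \<open>For each point \<open>a\<close> there is, up to scalars and modulo \<open>I\<close>, at most one common eigenvector in degree
  \<open>j - \<tau>\<close>. Choose \<open>F\<close> in the inverse system with \<open>F(l\<^sup>\<tau> h) \<noteq> 0\<close> for these finitely many \<open>h\<close>; this is
  possible because \<open>l\<^sup>\<tau> h \<notin> I\<close>. If the radical were larger than \<open>I\<close>, it would contain one of the \<open>h\<close>.\<close>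

lemma nondegenerate_exists:
  fixes I :: "('v::finite, 'k::alg_closed_field) mpoly set"
  assumes Z: "zero_dim_subscheme I s" and gor: "locally_gorenstein I" and j: "2 * tau I s \<le> j"
  obtains F where "nondegenerate I (tau I s) j F"
proof -
  obtain l where l: "regular_on I l" using regular_linear_form_exists[OF Z] .
  note I = zero_dim_ideal[OF Z l]
  note I1 = I(1)
  have l1: "l \<in> homog 1" using l by (simp add: regular_on_def)
  define t where "t = tau I s"
  define e where "e = j - t"
  have et: "t \<le> e" "t + e = j" using j by (auto simp: e_def t_def)
  \<comment> \<open>A point of the support has a unique representative on the hyperplane \<open>l = 1\<close>.\<close>
  define Z1 where "Z1 = {a \<in> zeros I. eval_mpoly l a = 1}"
  have "finite (proj_point ` Z1)"
    using Z finite_subset[of "proj_point ` Z1" "support I"]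
    by (auto simp: Z1_def zero_dim_subscheme_def support_def)
  moreover have "inj_on proj_point Z1"
  proof (rule inj_onI)
    fix a b assume ab: "a \<in> Z1" "b \<in> Z1" "proj_point a = proj_point b"
    have "a \<in> proj_point a" unfolding proj_point_def by (auto intro: exI[of _ 1])
    then obtain c where c: "a = (\<lambda>v. c * b v)" unfolding ab by (auto simp: proj_point_def)
    have "c = 1" using ab eval_homog_scaled[OF l1, of c b] c by (simp add: Z1_def)
    then show "a = b" using c by simp
  qed
  ultimately have finZ1: "finite Z1" by (rule finite_imageD)
  define eig where "eig a = {h \<in> homog e. h \<notin> I \<and> (\<forall>w. Var w * h - scale_mpoly (a w) (l * h) \<in> I)}" for a
  define ha where "ha a = (SOME h. h \<in> eig a)" for a
  define S where "S = {a \<in> Z1. eig a \<noteq> {}}"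
  have ha: "ha a \<in> eig a" if "a \<in> S" for a
    using that someI_ex[of "\<lambda>h. h \<in> eig a"] by (auto simp: S_def ha_def)
  define W where "W = inverse_system I j"
  have W: "W = perp j (I \<inter> homog j)" by (simp add: W_def inverse_system_eq_perp[OF I1])
  have Ij: "mp.subspace (I \<inter> homog j)"
    using is_ideal_subspace[OF I1] homog_subspace by (rule mp.subspace_inter)
  have ex: "\<exists>F\<in>W. ip (l ^ t * ha a) F \<noteq> 0" if a: "a \<in> S" for a
  proof (rule ccontr)
    assume *: "\<not> (\<exists>F\<in>W. ip (l ^ t * ha a) F \<noteq> 0)"
    have "l ^ t * ha a \<in> homog j"
      using homog_mult[OF homog_power_1[OF l1, of t], of "ha a" e] ha[OF a] et by (auto simp: eig_def)
    then have "l ^ t * ha a \<in> perp j W" using * unfolding perp_def by (auto simp: ip_commute)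
    then have "l ^ t * ha a \<in> I" unfolding W perp_perp[OF Ij Int_lower2] by blast
    then have "ha a \<in> I" by (rule regular_on_power[OF l])
    then show False using ha[OF a] by (simp add: eig_def)
  qed
  have "\<exists>F\<in>W. \<forall>a\<in>S. ip (l ^ t * ha a) F \<noteq> 0"
    by (rule avoid_hyperplanes[OF infinite_UNIV_alg_closed])
       (use finZ1 ex in \<open>auto simp: W perp_subspace S_def ip_add_right ip_scale_right\<close>)
  then obtain F where F: "F \<in> W" "\<And>a. a \<in> S \<Longrightarrow> ip (l ^ t * ha a) F \<noteq> 0" by blast
  have ipI: "ip h F = 0" if "h \<in> I" "h \<in> homog j" for h
    using inverse_system_ip[OF I1 F(1)[unfolded W_def] that] .
  define N where "N = {h \<in> homog e. \<forall>g\<in>homog t. ip (g * h) F = 0}"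
  have gh: "g * h \<in> homog j" if "g \<in> homog t" "h \<in> homog e" for g h
    using homog_mult[OF that] et by simp
  have "N \<subseteq> I"
  proof (rule ccontr)
    assume NI: "\<not> N \<subseteq> I"
    have subN: "mp.subspace N"
      by (rule mp.subspaceI)
         (auto simp: N_def distrib_left ip_add_left scale_mult_right ip_scale_left homog_add homog_scale)
    have Ne: "N \<subseteq> homog e" "I \<inter> homog e \<subseteq> N"
      by (auto simp: N_def intro!: ipI is_ideal_mult(1)[OF I1] gh)
    have lreg: "\<And>g. l * g \<in> I \<Longrightarrow> g \<in> I" using l by (simp add: regular_on_def)
    \<comment> \<open>If \<open>x\<^sub>w h = l h'\<close> and \<open>x\<^sub>w g = l g'\<close> in \<open>R/I\<close>, then \<open>g h' = g' h\<close> there, so \<open>h'\<close> is in the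
      radical together with \<open>h\<close>.\<close>
    have stable: "\<exists>h'\<in>N. Var w * h - l * h' \<in> I" if h: "h \<in> N" for h w
    proof -
      have he: "h \<in> homog e" using h Ne by blast
      obtain h' where h': "h' \<in> homog e" "Var w * h - l * h' \<in> I"
        using regular_form_surjective[OF Z l, of e "Var w * h"] et
          homog_mult[OF homog_Var(1) he, of w] by (auto simp: t_def)
      have "ip (g * h') F = 0" if g: "g \<in> homog t" for g
      proof -
        obtain g' where g': "g' \<in> homog t" "Var w * g - l * g' \<in> I"
          using regular_form_surjective[OF Z l, of t "Var w * g"]
            homog_mult[OF homog_Var(1) g, of w] by (auto simp: t_def)
        have "h * (Var w * g - l * g') - g * (Var w * h - l * h') \<in> I"
          by (rule is_ideal_diff[OF I1 is_ideal_mult(1)[OF I1 g'(2)] is_ideal_mult(1)[OF I1 h'(2)]])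
        also have "h * (Var w * g - l * g') - g * (Var w * h - l * h') = l * (g * h' - g' * h)"
          by (simp add: algebra_simps)
        finally have "g * h' - g' * h \<in> I" by (rule lreg)
        then have "ip (g * h' - g' * h) F = 0"
          by (rule ipI) (intro homog_diff gh g g' h' he)
        then show ?thesis using h g' by (simp add: ip_diff_left N_def)
      qed
      then show ?thesis using h' by (auto simp: N_def)
    qed
    obtain a h where h: "h \<in> N" "h \<notin> I" and ev: "\<And>w. Var w * h - scale_mpoly (a w) (l * h) \<in> I"
      using common_eigenvector_mod_ideal_exists[OF I1 lreg subN Ne(1) NI Ne(2) stable] by metis
    note az = eigenvalues_zero[OF I1 l h(2) ev I(2) order_refl]
    have he: "h \<in> homog e" using h Ne by blast
    have "h \<in> eig a" using h ev he by (simp add: eig_def)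
    then have aS: "a \<in> S" using az by (auto simp: S_def Z1_def)
    have hae: "ha a \<in> homog e" "ha a \<notin> I" "\<And>w. Var w * ha a - scale_mpoly (a w) (l * ha a) \<in> I"
      using ha[OF aS] by (auto simp: eig_def)
    have "gorenstein_artinian (local_ring I a)" using gor az(2) by (simp add: locally_gorenstein_def)
    then obtain c where c: "h - scale_mpoly c (ha a) \<in> I"
      using gorenstein_eigenvector_unique[OF I1 az(2) l az(1) _ hae(1,2) he hae(3) ev] by blast
    have c0: "c \<noteq> 0" using c h(2) by auto
    have lt: "l ^ t \<in> homog t" by (rule homog_power_1[OF l1])
    have "ip (l ^ t * (h - scale_mpoly c (ha a))) F = 0"
      by (rule ipI[OF is_ideal_mult(1)[OF I1 c]]) (intro gh lt homog_diff homog_scale he hae)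
    then have "ip (l ^ t * h) F = c * ip (l ^ t * ha a) F"
      by (simp add: right_diff_distrib ip_diff_left scale_mult_right ip_scale_left)
    also have "\<dots> \<noteq> 0" using c0 F(2)[OF aS] by simp
    finally show False using h(1) lt by (simp add: N_def)
  qed
  then have "nondegenerate I (tau I s) j F"
    using F(1) by (auto simp: nondegenerate_def W_def N_def e_def t_def)
  then show ?thesis by (rule that)
qed

subsection \<open>Nondegeneracy is an open condition\<close>

text \<open>The linear functional \<open>F \<mapsto> F(f)\<close> as a polynomial in the coefficients of \<open>F\<close>, which are variables
  indexed by exponent vectors.\<close>

definition ip_poly :: "('a \<Rightarrow>\<^sub>0 'k::field) \<Rightarrow> ('a, 'k) mpoly" where
  "ip_poly f = (\<Sum>m\<in>Poly_Mapping.keys f. Poly_Mapping.single (Poly_Mapping.single m 1) (coef f m))"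

lemma eval_ip_poly: "eval_mpoly (ip_poly f) (coef F) = ip f F"
  by (simp add: ip_poly_def eval_sum ip_def)

lemma eval_comm_ring_hom: "comm_ring_hom (\<lambda>P :: ('x, 'k::field) mpoly. eval_mpoly P x)"
  by unfold_locales (simp_all add: eval_add eval_mult)

text \<open>In bases of \<open>(R/I)\<^sub>\<tau>\<close> and \<open>(R/I)\<^sub>j\<^sub>-\<^sub>\<tau>\<close>, both of size \<open>s\<close>, the form is a square matrix.\<close>

lemma nondegenerate_generally:
  fixes I :: "('v::finite, 'k::alg_closed_field) mpoly set"
  assumes Z: "zero_dim_subscheme I s" and gor: "locally_gorenstein I" and j: "2 * tau I s \<le> j"
  shows "holds_generally (inverse_system I j) (nondegenerate I (tau I s) j)"
proof -
  obtain l where l: "regular_on I l" using regular_linear_form_exists[OF Z] .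
  note I1 = zero_dim_ideal(1)[OF Z l]
  define t where "t = tau I s"
  define e where "e = j - t"
  have et: "t \<le> e" "t + e = j" using j by (auto simp: e_def t_def)
  have basis: "\<exists>b. rel_basis scale_mpoly (I \<inter> homog i) (homog i) s b" if "t \<le> i" for i
    using homog_rel_basis_exists[OF mp.subspace_inter[OF is_ideal_subspace[OF I1] homog_subspace]
        homog_subspace Int_lower2 order_refl, of i] hilbert_fun_eq_degree[OF Z l] that
    by (metis hilbert_fun_def dim_mpoly_def t_def)
  obtain b where b: "rel_basis scale_mpoly (I \<inter> homog t) (homog t) s b" using basis by blast
  obtain b' where b': "rel_basis scale_mpoly (I \<inter> homog e) (homog e) s b'" using basis et by blast
  define A where "A F = mat s s (\<lambda>(x, y). ip (b x * b' y) F)" for F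
  define P where "P = det (mat s s (\<lambda>(x, y). ip_poly (b x * b' y)))"
  have A: "A F \<in> carrier_mat s s" for F by (simp add: A_def)
  have P: "eval_mpoly P (coef F) = det (A F)" for F
  proof -
    interpret comm_ring_hom "\<lambda>P :: (('v \<Rightarrow>\<^sub>0 nat), 'k) mpoly. eval_mpoly P (coef F)"
      by (rule eval_comm_ring_hom)
    have "map_mat (\<lambda>P. eval_mpoly P (coef F)) (mat s s (\<lambda>(x, y). ip_poly (b x * b' y))) = A F"
      by (rule eq_matI) (auto simp: A_def eval_ip_poly)
    then show ?thesis unfolding P_def by (metis hom_det)
  qed
  have gh: "g * h \<in> homog j" if "g \<in> homog t" "h \<in> homog e" for g h :: "('v, 'k) mpoly"
    using homog_mult[OF that] et by simp
  have bh: "b x \<in> homog t" "b' x \<in> homog e" if "x < s" for x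
    using b b' that by (auto simp: rel_basis_def)
  have Av: "(A F *\<^sub>v v) $ x = ip (b x * (\<Sum>y<s. scale_mpoly (v $ y) (b' y))) F"
    if "v \<in> carrier_vec s" "x < s" for F v x
    using that by (simp add: A_def scalar_prod_def atLeast0LessThan sum_distrib_left ip_sum_left
        scale_mult_right ip_scale_left mult.commute)
  have nd: "nondegenerate I t j F \<longleftrightarrow> det (A F) \<noteq> 0" if F: "F \<in> inverse_system I j" for F
  proof
    assume nd: "nondegenerate I t j F"
    show "det (A F) \<noteq> 0"
    proof
      assume "det (A F) = 0"
      then obtain v where v: "v \<in> carrier_vec s" "v \<noteq> 0\<^sub>v s" "A F *\<^sub>v v = 0\<^sub>v s"
        using det_0_iff_vec_prod_zero[OF A] by blast
      define h where "h = (\<Sum>y<s. scale_mpoly (v $ y) (b' y))"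
      have he: "h \<in> homog e" unfolding h_def by (intro homog_sum homog_scale bh) auto
      have bx: "ip (b x * h) F = 0" if "x < s" for x
        using Av[OF v(1) that, of F] v(3) that by (simp add: h_def)
      have "ip (g * h) F = 0" if g: "g \<in> homog t" for g
      proof -
        obtain c where c: "g - (\<Sum>x<s. scale_mpoly (c x) (b x)) \<in> I \<inter> homog t"
          using b g by (auto simp: rel_basis_def)
        have "ip ((g - (\<Sum>x<s. scale_mpoly (c x) (b x))) * h) F = 0"
          using c by (intro inverse_system_ip[OF I1 F] is_ideal_mult(2)[OF I1] gh he) auto
        then show ?thesis
          by (simp add: left_diff_distrib ip_diff_left sum_distrib_right ip_sum_left scale_mult_left
              ip_scale_left bx)
      qed
      then have "h \<in> I" using nd he by (auto simp: nondegenerate_def e_def)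
      then have "\<forall>y<s. v $ y = 0" using b' he unfolding h_def rel_basis_def by blast
      then have "v = 0\<^sub>v s" using v by (intro eq_vecI) auto
      with v show False by simp
    qed
  next
    assume det: "det (A F) \<noteq> 0"
    show "nondegenerate I t j F"
      unfolding nondegenerate_def e_def[symmetric]
    proof (intro conjI ballI impI F)
      fix h :: "('v, 'k) mpoly" assume h: "h \<in> homog e" "\<forall>g\<in>homog t. ip (g * h) F = 0"
      obtain c where c: "h - (\<Sum>y<s. scale_mpoly (c y) (b' y)) \<in> I \<inter> homog e"
        using b' h by (auto simp: rel_basis_def)
      define v where "v = vec s c"
      have v: "v \<in> carrier_vec s" by (simp add: v_def)
      have "A F *\<^sub>v v = 0\<^sub>v s"
      proof (rule eq_vecI)
        fix x assume "x < dim_vec (0\<^sub>v s :: 'k vec)"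
        then have x: "x < s" by simp
        have "ip (b x * (h - (\<Sum>y<s. scale_mpoly (c y) (b' y)))) F = 0"
          using c by (intro inverse_system_ip[OF I1 F] is_ideal_mult(1)[OF I1] gh bh x) auto
        then have "ip (b x * (\<Sum>y<s. scale_mpoly (c y) (b' y))) F = 0"
          using h(2) bh(1)[OF x] by (simp add: right_diff_distrib ip_diff_left)
        then show "(A F *\<^sub>v v) $ x = 0\<^sub>v s $ x"
          using x by (simp add: Av[OF v x] del: index_mult_mat_vec) (simp add: v_def)
      qed (simp add: A_def)
      then have "v = 0\<^sub>v s" using det det_0_iff_vec_prod_zero[OF A] v by blast
      then have "c y = 0" if "y < s" for y using that by (metis index_vec index_zero_vec(1) v_def)
      then show "h \<in> I" using c by simp
    qed
  qed
  obtain F where F: "nondegenerate I t j F"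
    using nondegenerate_exists[OF Z gor j] by (auto simp: t_def)
  define U where "U = {F \<in> inverse_system I j. \<exists>Q\<in>{P}. eval_mpoly Q (coef F) \<noteq> 0}"
  have "zariski_open_in (inverse_system I j) U"
    unfolding zariski_open_in_def U_def by blast
  moreover have "F \<in> U" using F nd[of F] by (auto simp: U_def P nondegenerate_def)
  moreover have "\<forall>F\<in>U. nondegenerate I t j F" using nd by (auto simp: U_def P)
  ultimately show ?thesis unfolding holds_generally_def t_def by blast
qed

lemma holds_generally_mono:
  "holds_generally W Q \<Longrightarrow> (\<And>F. Q F \<Longrightarrow> Q' F) \<Longrightarrow> holds_generally W Q'"
  by (auto simp: holds_generally_def)

section \<open>Annihilators of nondegenerate elements\<close>

lemma Ann_subspace: "mp.subspace (Ann F)"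
  by (rule mp.subspaceI) (auto simp: Ann_def contract_add contract_scale)

lemma hilbert_fun_Ann_symmetric:
  fixes F :: "('v::finite, 'k::field) dpoly"
  assumes F: "F \<in> homog j" and i: "i \<le> j"
  shows "hilbert_fun (Ann F) i = hilbert_fun (Ann F) (j - i)"
proof -
  have sub: "mp.subspace (Ann F \<inter> homog k)" for k
    using Ann_subspace homog_subspace by (rule mp.subspace_inter)
  show ?thesis
    unfolding hilbert_fun_def dim_mpoly_def
  proof (rule pairing_codim_eq[of "\<lambda>x y. ip (x * y) F"])
    show "x \<in> Ann F \<inter> homog i \<longleftrightarrow> (\<forall>y\<in>homog (j - i). ip (x * y) F = 0)" if "x \<in> homog i" for x
      using that contract_homog_eq_0_iff[OF that F i] by (simp add: Ann_def mult.commute)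
    show "y \<in> Ann F \<inter> homog (j - i) \<longleftrightarrow> (\<forall>x\<in>homog i. ip (x * y) F = 0)" if "y \<in> homog (j - i)" for y
      using that contract_homog_eq_0_iff[OF that F] i by (simp add: Ann_def)
  qed (auto simp: sub homog_subspace distrib_left distrib_right ip_add_left scale_mult_left
      scale_mult_right ip_scale_left)
qed

context
  fixes I :: "('v::finite, 'k::field) mpoly set" and t j :: nat and F
  assumes I: "is_ideal I" "saturated I" and F: "nondegenerate I t j F"
begin

lemma nondegenerate_homog: "F \<in> homog j"
  using F by (simp add: nondegenerate_def inverse_system_def)

text \<open>If \<open>h\<close> annihilates \<open>F\<close>, then so do its multiples in degree \<open>j - t\<close>, which nondegeneracy puts in \<open>I\<close>;
  saturation descends to \<open>h\<close>.\<close>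

lemma Ann_eq_ideal:
  assumes "i + t \<le> j"
  shows "Ann F \<inter> homog i = I \<inter> homog i"
proof
  show "Ann F \<inter> homog i \<subseteq> I \<inter> homog i"
  proof
    fix h assume "h \<in> Ann F \<inter> homog i"
    then have h: "h \<in> Ann F" "h \<in> homog i" by auto
    have "g' * h \<in> I" if g': "g' \<in> homog (j - t - i)" for g'
    proof -
      have "g' * h \<in> homog (j - t)" using homog_mult[OF g' h(2)] assms by simp
      moreover have "ip (g * (g' * h)) F = 0" for g
        using h(1) contract_eq_0_iff[of h F] by (simp add: Ann_def mult.assoc[symmetric])
      ultimately show ?thesis using F by (simp add: nondegenerate_def)
  qed
  then show "h \<in> I \<inter> homog i" using I(2) h by (auto simp: saturated_def)
  qed
  show "I \<inter> homog i \<subseteq> Ann F \<inter> homog i"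
  proof
    fix h assume "h \<in> I \<inter> homog i"
    then have h: "h \<in> I" "h \<in> homog i" by auto
    have "ip (g * h) F = 0" if "g \<in> homog (j - i)" for g
      using homog_mult[OF that h(2)] assms F
      by (intro inverse_system_ip[OF I(1) _ is_ideal_mult(1)[OF I(1) h(1)]]) (auto simp: nondegenerate_def)
    then show "h \<in> Ann F \<inter> homog i"
      using contract_homog_eq_0_iff[OF h(2) nondegenerate_homog] h assms by (simp add: Ann_def)
  qed
qed

lemma hilbert_fun_Ann:
  assumes "2 * t \<le> j"
  shows "hilbert_fun (Ann F) = Sym (hilbert_fun I) j"
proof
  fix i
  have low: "hilbert_fun (Ann F) k = hilbert_fun I k" if "k + t \<le> j" for k
    unfolding hilbert_fun_def Ann_eq_ideal[OF that] ..
  consider "2 * i \<le> j" | "j < 2 * i" "i \<le> j" | "j < i" by linarith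
  then show "hilbert_fun (Ann F) i = Sym (hilbert_fun I) j i"
  proof cases
    case 1
    then show ?thesis using low[of i] assms by (simp add: Sym_def)
  next
    case 2
    then show ?thesis
      using low[of "j - i"] assms hilbert_fun_Ann_symmetric[OF nondegenerate_homog 2(2)] by (simp add: Sym_def)
  next
    case 3
    have "Ann F \<inter> homog i = homog i"
      using contract_high_degree[OF _ nondegenerate_homog 3] by (auto simp: Ann_def)
    then show ?thesis using 3 by (simp add: Sym_def hilbert_fun_def)
  qed
qed

text \<open>By adjunction the orthogonal complement of the space of contractions is \<open>Ann(F)\<^sub>i = I\<^sub>i\<close>.\<close>

lemma contractions_eq_inverse_system:
  assumes "i + t \<le> j"
  shows "(\<lambda>h. contract h F) ` homog (j - i) = inverse_system I i"
proof -
  let ?C = "(\<lambda>h. contract h F) ` homog (j - i)"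
  have "mp.subspace ?C"
  proof (rule mp.subspaceI)
    show "0 \<in> ?C" by (rule image_eqI[of _ _ 0]) auto
    show "x + y \<in> ?C" if "x \<in> ?C" "y \<in> ?C" for x y
      using that by (auto simp: contract_add[symmetric] intro!: imageI homog_add)
    show "scale_mpoly c x \<in> ?C" if "x \<in> ?C" for c x
      using that by (auto simp: contract_scale[symmetric] intro!: imageI homog_scale)
  qed
  moreover have "?C \<subseteq> homog i"
    using contract_homog[OF _ nondegenerate_homog, of _ "j - i"] assms by auto
  moreover have "perp i ?C = I \<inter> homog i"
  proof -
    have "f \<in> perp i ?C \<longleftrightarrow> f \<in> Ann F \<inter> homog i" for f
    proof (cases "f \<in> homog i")
      case True
      then show ?thesis
        using contract_homog_eq_0_iff[OF True nondegenerate_homog] assms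
        by (simp add: perp_def Ann_def ip_commute[of _ f] ip_contract mult.commute)
    qed (simp add: perp_def)
    then show ?thesis using Ann_eq_ideal[OF assms] by blast
  qed
  ultimately show ?thesis
    unfolding inverse_system_eq_perp[OF I(1)] by (metis perp_perp)
qed

end

section \<open>Recovering the scheme\<close>

text \<open>The saturation of the ideal generated by the degree \<open>d\<close> part of \<open>J\<close>.\<close>

definition recover_ideal :: "nat \<Rightarrow> ('v::finite, 'k::field) mpoly set \<Rightarrow> ('v, 'k) mpoly set" where
  "recover_ideal d J = {f. \<exists>N. \<forall>g\<in>homog N. g * f \<in> ideal_gen (J \<inter> homog d)}"

lemma ideal_gen_minimal: "S \<subseteq> I \<Longrightarrow> is_ideal I \<Longrightarrow> ideal_gen S \<subseteq> I"
  unfolding ideal_gen_def is_ideal_def by (rule Modules.module.span_minimal[OF mult_module])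

lemma ideal_gen_superset: "S \<subseteq> ideal_gen S"
  unfolding ideal_gen_def by (rule Modules.module.span_superset[OF mult_module])

lemma mult_mem_of_low_degree:
  assumes J: "is_ideal J" "I \<inter> homog d \<subseteq> J" and I: "is_ideal I"
    and f: "f \<in> I \<inter> homog i" "i \<le> d"
  shows "g \<in> homog d \<Longrightarrow> g * f \<in> J"
proof -
  have "g * f \<in> J" if "g \<in> homog (k + (d - i))" for g k
    using that
  proof (induct k arbitrary: g)
    case 0
    then have "g * f \<in> homog d" using homog_mult[of g "d - i" f i] f by simp
    then show ?case using J f is_ideal_mult(1)[OF I] by blast
  next
    case (Suc k)
    have S: "mp.subspace {g. g * f \<in> J}"
      using is_ideal_0[OF J(1)] is_ideal_add[OF J(1)] is_ideal_scale[OF J(1)]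
      by (intro mp.subspaceI) (auto simp: distrib_right scale_mult_left)
    have "g \<in> {g. g * f \<in> J}"
    proof (rule homog_Suc_induct[OF _ S])
      show "g \<in> homog (Suc (k + (d - i)))" using Suc.prems by simp
      show "Var v * g' \<in> {g. g * f \<in> J}" if "g' \<in> homog (k + (d - i))" for v g'
        using is_ideal_mult(1)[OF J(1) Suc.hyps[OF that], of "Var v"] by (simp add: mult.assoc)
    qed
    then show ?case by simp
  qed
  from this[of g i] show "g \<in> homog d \<Longrightarrow> g * f \<in> J" using f by simp
qed

text \<open>Every form of degree \<open>d\<close> multiplies \<open>I\<close> into the ideal generated by \<open>I\<^sub>d\<close>: components of \<open>f \<in> I\<close> of
  degree at most \<open>d\<close> are carried to degree \<open>d\<close> first, and those above lie in that ideal already.\<close>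

lemma recover_ideal_eq:
  fixes I :: "('v::finite, 'k::alg_closed_field) mpoly set"
  assumes Z: "zero_dim_subscheme I s"
    and d: "tau I s < d \<or> I = ideal_gen (I \<inter> homog (tau I s)) \<and> tau I s \<le> d"
  shows "recover_ideal d I = I"
proof -
  obtain l where l: "regular_on I l" using regular_linear_form_exists[OF Z] .
  note I = zero_dim_ideal[OF Z l]
  define J where "J = ideal_gen (I \<inter> homog d)"
  have J: "is_ideal J" "I \<inter> homog d \<subseteq> J" "J \<subseteq> I"
    unfolding J_def by (rule is_ideal_ideal_gen ideal_gen_superset ideal_gen_minimal[OF Int_lower1 I(1)])+
  have "g * f \<in> J" if f: "f \<in> I" and g: "g \<in> homog d" for f g
    using d
  proof
    assume d: "tau I s < d"
    have "g * hom_component i f \<in> J" for i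
    proof (cases "i \<le> d")
      case True
      then show ?thesis
        using mult_mem_of_low_degree[OF J(1,2) I(1) _ True g] homogeneous_idealD(2)[OF I(2) f] homog_hom_component
        by blast
    next
      case False
      then have "hom_component i f \<in> J"
        using ideal_generated_above_tau[OF Z l J(1,3) d J(2), of i] homogeneous_idealD(2)[OF I(2) f]
          homog_hom_component[of i f] by auto
      then show ?thesis by (rule is_ideal_mult(1)[OF J(1)])
    qed
    moreover obtain B where "f = (\<Sum>i<B. hom_component i f)" using sum_hom_components by blast
    ultimately show "g * f \<in> J"
      using is_ideal_sum[OF J(1), of "{..<B}" "\<lambda>i. g * hom_component i f"]
      by (simp add: sum_distrib_left[symmetric])
  next
    assume d: "I = ideal_gen (I \<inter> homog (tau I s)) \<and> tau I s \<le> d"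
    have "is_ideal {f. g * f \<in> J}"
      unfolding is_ideal_iff
      using is_ideal_0[OF J(1)] is_ideal_add[OF J(1)] is_ideal_mult(1)[OF J(1)]
      by (simp add: distrib_left mult.left_commute)
    moreover have "I \<inter> homog (tau I s) \<subseteq> {f. g * f \<in> J}"
      using mult_mem_of_low_degree[OF J(1,2) I(1) _ _ g] d by blast
    ultimately have "ideal_gen (I \<inter> homog (tau I s)) \<subseteq> {f. g * f \<in> J}" by (intro ideal_gen_minimal)
    then show "g * f \<in> J" using d f by auto
  qed
  then have "I \<subseteq> recover_ideal d I" by (auto simp: recover_ideal_def J_def)
  moreover have "recover_ideal d I \<subseteq> I"
    using I(3) J(3) unfolding recover_ideal_def saturated_def J_def by blast
  ultimately show ?thesis by blast
qed

theorem theorem3p3: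
  fixes j :: nat
  assumes "CHAR('k::alg_closed_field) = 0 \<or> CHAR('k) > j"
  shows
    "(\<forall>(I :: ('v::finite, 'k) mpoly set) s.
        zero_dim_subscheme I s \<and> locally_gorenstein I \<and> j \<ge> beta I s \<longrightarrow>
        holds_generally (inverse_system I j)
          (\<lambda>F. hilbert_fun (Ann F) = Sym (hilbert_fun I) j)) \<and>
     (\<forall>(I :: ('v, 'k) mpoly set) s.
        zero_dim_subscheme I s \<and> locally_gorenstein I \<and> j \<ge> beta I s \<longrightarrow>
        holds_generally (inverse_system I j)
          (\<lambda>F. \<forall>i. tau I s \<le> i \<and> i \<le> j - alpha I \<and> i \<le> j - tau I s \<longrightarrow>
                 Ann F \<inter> homog i = I \<inter> homog i \<and>
                 (\<lambda>h. contract h F) ` homog (j - i) = inverse_system I i)) \<and>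
     (\<exists>recover :: ('v, 'k) mpoly set \<Rightarrow> ('v, 'k) mpoly set.
        \<forall>I s.
          zero_dim_subscheme I s \<and> locally_gorenstein I \<and>
          (j \<ge> max (beta I s) (2 * tau I s + 1) \<or>
           I = ideal_gen (I \<inter> homog (tau I s)) \<and> j \<ge> max (beta I s) (2 * tau I s)) \<longrightarrow>
          holds_generally (inverse_system I j) (\<lambda>F. recover (Ann F) = I))"
proof -
  have beta: "2 * tau I s \<le> beta I s" for I :: "('v, 'k) mpoly set" and s
    by (simp add: beta_def)
  have ideal: "is_ideal I" "saturated I" if "zero_dim_subscheme I s" for I :: "('v, 'k) mpoly set" and s
    using that by (auto simp: zero_dim_subscheme_def homogeneous_ideal_def)
  have general: "holds_generally (inverse_system I j) (nondegenerate I (tau I s) j)"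
    if "zero_dim_subscheme I s" "locally_gorenstein I" "beta I s \<le> j" for I :: "('v, 'k) mpoly set" and s
    using nondegenerate_generally[OF that(1,2)] beta that(3) by (meson le_trans)
  show ?thesis
  proof (intro conjI exI allI impI; elim conjE)
    fix I :: "('v, 'k) mpoly set" and s
    assume Z: "zero_dim_subscheme I s" "locally_gorenstein I" and j: "beta I s \<le> j"
    have j2: "2 * tau I s \<le> j" using beta j by (rule le_trans)
    show "holds_generally (inverse_system I j) (\<lambda>F. hilbert_fun (Ann F) = Sym (hilbert_fun I) j)"
      by (rule holds_generally_mono[OF general[OF Z j]]) (rule hilbert_fun_Ann[OF ideal[OF Z(1)] _ j2])
    show "holds_generally (inverse_system I j)
        (\<lambda>F. \<forall>i. tau I s \<le> i \<and> i \<le> j - alpha I \<and> i \<le> j - tau I s \<longrightarrow>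
           Ann F \<inter> homog i = I \<inter> homog i \<and>
           (\<lambda>h. contract h F) ` homog (j - i) = inverse_system I i)"
    proof (rule holds_generally_mono[OF general[OF Z j]], intro allI impI, elim conjE)
      fix F i assume F: "nondegenerate I (tau I s) j F" and i: "i \<le> j - tau I s"
      have "i + tau I s \<le> j" using i j2 by linarith
      then show "Ann F \<inter> homog i = I \<inter> homog i \<and>
          (\<lambda>h. contract h F) ` homog (j - i) = inverse_system I i"
        using Ann_eq_ideal[OF ideal[OF Z(1)] F] contractions_eq_inverse_system[OF ideal[OF Z(1)] F] by blast
    qed
  next
    fix I :: "('v, 'k) mpoly set" and s
    assume Z: "zero_dim_subscheme I s" "locally_gorenstein I"
      and j: "j \<ge> max (beta I s) (2 * tau I s + 1) \<or>
           I = ideal_gen (I \<inter> homog (tau I s)) \<and> j \<ge> max (beta I s) (2 * tau I s)"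
    \<comment> \<open>This degree depends on \<open>j\<close> alone, so the same recovery works for all schemes; it exceeds
      \<open>\<tau>\<close> if \<open>j \<ge> 2\<tau> + 1\<close>, is at least \<open>\<tau>\<close> if \<open>j \<ge> 2\<tau>\<close>, and is at most \<open>j - \<tau>\<close> in both cases.\<close>
    define d where "d = (j + 1) div 2"
    have jb: "beta I s \<le> j" using j by auto
    have d: "tau I s < d \<or> I = ideal_gen (I \<inter> homog (tau I s)) \<and> tau I s \<le> d" "d + tau I s \<le> j"
      using j by (auto simp: d_def)
    show "holds_generally (inverse_system I j) (\<lambda>F. recover_ideal ((j + 1) div 2) (Ann F) = I)"
    proof (rule holds_generally_mono[OF general[OF Z jb]])
      fix F assume F: "nondegenerate I (tau I s) j F"
      have "recover_ideal d (Ann F) = recover_ideal d I"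
        unfolding recover_ideal_def Ann_eq_ideal[OF ideal[OF Z(1)] F d(2)] ..
      then show "recover_ideal ((j + 1) div 2) (Ann F) = I"
        using recover_ideal_eq[OF Z(1) d(1)] by (simp add: d_def)
    qed
  qed
qed

end
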